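(* Let $f,M,L,u_\pm$ satisfy (A0)–(A4) and let $(U,Q)$ be a stationary radiative shock profile satisfying (A5$_k$), $k=1,\dots,4$ (see context). The spectral stability condition (D) holds under either of the following conditions: (i) the function $b(x)=M'(U(x))$ is constant; or (ii) $|u_+-u_-|$ is sufficiently small.
   Context: Setting. $L\in\mathbb R$ is a constant, $u_\pm\in\mathbb R$, and $f,M$ are real functions of one real variable. Structural assumptions, for $u\in[u_+,u_-]$ (and all $u$ under consideration): (A0) $f,M\in C^5$; (A1) $f''(u)>0$; (A2) $f(u_-)=f(u_+)$; (A3) $u_+<u_-$; (A4) $L\,M'(u)>0$. A stationary radiative shock profile is a solution $(U,Q)(x)$, $x\in\mathbb R$, of $f(U)'+LQ'=0$, $-Q''+Q+M(U)'=0$ with $\lim_{x\to\pm\infty}(U,Q)(x)=(u_\pm,0)$; it is assumed regular enough that the derivatives below make sense. Put $a(x):=f'(U(x))$, $b(x):=M'(U(x))$, with the profile translated so that $a(0)=0$ ($a$ vanishes only at $0$, $a'<0$). Condition (A5$_k$): $Lb(0)+(k+\tfrac12)a'(0)>0$. Evans functions and condition (D). For $\lambda\in\mathbb C$ consider, for $W=(u,q,p)^\top$, separately on $x<0$ and $x>0$, the system $$a\,u'=-(\lambda+a'+Lb)u+Lp,\qquad q'=b\,u-p,\qquad p'=-q$$ (equivalent, with $p=bu-q'$, to $(au)'=-\lambda u-Lq'$, $q''=q+(bu)'$, the eigenvalue equations of the linearization about the profile). Let $a_\pm=f'(u_\pm)$, $b_\pm=M'(u_\pm)$, so $a_+<0<a_-$.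 For $\operatorname{Re}\lambda\ge0$, $\lambda\ne0$, the limiting constant-coefficient system at $+\infty$ has exactly one eigenvalue $\mu_3^+(\lambda)$ with negative real part and the one at $-\infty$ has exactly one eigenvalue $\mu_3^-(\lambda)$ with positive real part. Let $\nu:=(\operatorname{Re}\lambda+a'(0)+Lb(0))/|a'(0)|$. Define, analytically in $\lambda$, nontrivial solutions as follows. For $y<0$: $W_3^-$ is the solution on $x<0$ decaying as $x\to-\infty$ (rate $\mu_3^-$); $W_2^+$ is identically $0$ for $x>0$ and, for $x<0$, is the (unique up to a scalar) solution with $(u,q,p)\to0$ as $x\to0^-$, namely $|u|\sim|x|^\nu$, $(q,p)=O(|x|^\nu a(x))$; $W_1^+$ is the solution on $x>0$ decaying as $x\to+\infty$ (rate $\mu_3^+$), continued to $x<0$ as a solution with $q,p$ continuous across $x=0$ and $a u\to0$ as $x\to0$ (unique up to adding a multiple of $W_2^+$). For $y>0$ symmetrically: $W_1^+$ is the solution on $x>0$ decaying at $+\infty$; $W_2^-$ is identically $0$ for $x<0$ and, for $x>0$, the solution vanishing as $x\to0^+$ in the same way; $W_3^-$ is the solution decaying at $-\infty$ continued across $x=0$ to $x>0$ in the same way. Set $D_\pm(y,\lambda):=\det(W_1^+\ W_2^{\mp}\ W_3^-)(y,\lambda)$ for $y\gtrless0$ and $D_\pm(\lambda):=D_\pm(\pm1,\lambda)$. Condition (D): $D_+$ and $D_-$ have no zeroes in $\{\operatorname{Re}\lambda\ge0\}\setminus\{0\}$. *)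

theory Defs
  imports "HOL-Analysis.Analysis" "HOL-Library.Landau_Symbols"
begin

text \<open>Class $C^k$ on an open set.\<close>

definition Ck_on :: "nat \<Rightarrow> (real \<Rightarrow> real) \<Rightarrow> real set \<Rightarrow> bool" where
  "Ck_on k g S \<longleftrightarrow>
     (\<forall>i<k. \<forall>x\<in>S. (deriv ^^ i) g field_differentiable at x) \<and>
     continuous_on S ((deriv ^^ k) g)"

text \<open>The set \<open>I\<close> is the range of states under consideration (an open interval in the
  intended use). The condition \<open>deriv f (U 0) = 0\<close> is the normalization of the translate
  of the profile.\<close>

definition radiative_profile ::
  "real set \<Rightarrow> (real \<Rightarrow> real) \<Rightarrow> (real \<Rightarrow> real) \<Rightarrow> real \<Rightarrow> real \<Rightarrow> real \<Rightarrow>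
   (real \<Rightarrow> real) \<Rightarrow> (real \<Rightarrow> real) \<Rightarrow> bool" where
  "radiative_profile I f M L u_minus u_plus U Q \<longleftrightarrow>
     Ck_on 1 U UNIV \<and> Ck_on 2 Q UNIV \<and> range U \<subseteq> I \<and>
     (\<forall>x. deriv (\<lambda>s. f (U s)) x + L * deriv Q x = 0) \<and>
     (\<forall>x. - deriv (deriv Q) x + Q x + deriv (\<lambda>s. M (U s)) x = 0) \<and>
     (U \<longlongrightarrow> u_minus) at_bot \<and> (U \<longlongrightarrow> u_plus) at_top \<and>
     (Q \<longlongrightarrow> 0) at_bot \<and> (Q \<longlongrightarrow> 0) at_top \<and>
     deriv f (U 0) = 0"

definition A5 :: "nat \<Rightarrow> real \<Rightarrow> (real \<Rightarrow> real) \<Rightarrow> (real \<Rightarrow> real) \<Rightarrow> bool" where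
  "A5 k L a b \<longleftrightarrow> L * b 0 + (real k + 1/2) * deriv a 0 > 0"

text \<open>The components 1, 2, 3 of a vector \<open>W\<close> are \<open>u\<close>, \<open>q\<close>, \<open>p\<close>. The coefficient \<open>a\<close>
  of \<open>u'\<close> vanishes at \<open>0\<close>, so the system is imposed on sets \<open>S\<close> not containing \<open>0\<close>.\<close>

definition solves_eigen_system ::
  "real \<Rightarrow> (real \<Rightarrow> real) \<Rightarrow> (real \<Rightarrow> real) \<Rightarrow> complex \<Rightarrow> (real \<Rightarrow> complex^3) \<Rightarrow> real set \<Rightarrow> bool" where
  "solves_eigen_system L a b l W S \<longleftrightarrow> (\<forall>x\<in>S.
     (\<exists>u'. ((\<lambda>s. W s $ 1) has_vector_derivative u') (at x) \<and>
        of_real (a x) * u' =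
          - (l + of_real (deriv a x) + of_real (L * b x)) * W x $ 1 + of_real L * W x $ 3) \<and>
     ((\<lambda>s. W s $ 2) has_vector_derivative (of_real (b x) * W x $ 1 - W x $ 3)) (at x) \<and>
     ((\<lambda>s. W s $ 3) has_vector_derivative (- W x $ 2)) (at x))"

text \<open>Coefficient matrix of the limiting system at infinity, where \<open>a'\<close> tends to \<open>0\<close>; here
  \<open>ainf\<close> and \<open>binf\<close> are the limits of \<open>a\<close> and \<open>b\<close>.\<close>

definition limit_matrix :: "real \<Rightarrow> real \<Rightarrow> real \<Rightarrow> complex \<Rightarrow> complex^3^3" where
  "limit_matrix L ainf binf l = vector
     [vector [- (l + of_real (L * binf)) / of_real ainf, 0, of_real L / of_real ainf],
      vector [of_real binf, 0, - 1],
      vector [0, - 1, 0]]"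

definition is_eigenvalue :: "complex^'n^'n \<Rightarrow> complex \<Rightarrow> bool" where
  "is_eigenvalue A m \<longleftrightarrow> (\<exists>v. v \<noteq> 0 \<and> A *v v = m *s v)"

definition mu3_plus :: "real \<Rightarrow> real \<Rightarrow> real \<Rightarrow> complex \<Rightarrow> complex" where
  "mu3_plus L a_plus b_plus l =
     (THE m. is_eigenvalue (limit_matrix L a_plus b_plus l) m \<and> Re m < 0)"

definition mu3_minus :: "real \<Rightarrow> real \<Rightarrow> real \<Rightarrow> complex \<Rightarrow> complex" where
  "mu3_minus L a_minus b_minus l =
     (THE m. is_eigenvalue (limit_matrix L a_minus b_minus l) m \<and> Re m > 0)"

definition nu_exponent :: "real \<Rightarrow> (real \<Rightarrow> real) \<Rightarrow> (real \<Rightarrow> real) \<Rightarrow> complex \<Rightarrow> real" where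
  "nu_exponent L a b l = (Re l + deriv a 0 + L * b 0) / \<bar>deriv a 0\<bar>"

text \<open>Solutions on both sides of the singular point, matched there: the components \<open>q\<close>, \<open>p\<close>
  are continuous across \<open>0\<close> and \<open>a u\<close> tends to \<open>0\<close>. The value of \<open>u\<close> at \<open>0\<close> is irrelevant.\<close>

definition crossing_solution ::
  "real \<Rightarrow> (real \<Rightarrow> real) \<Rightarrow> (real \<Rightarrow> real) \<Rightarrow> complex \<Rightarrow> (real \<Rightarrow> complex^3) \<Rightarrow> bool" where
  "crossing_solution L a b l W \<longleftrightarrow>
     solves_eigen_system L a b l W {..<0} \<and> solves_eigen_system L a b l W {0<..} \<and>
     isCont (\<lambda>x. W x $ 2) 0 \<and> isCont (\<lambda>x. W x $ 3) 0 \<and>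
     ((\<lambda>x. of_real (a x) * W x $ 1) \<longlongrightarrow> 0) (at 0)"

definition is_W1_plus ::
  "real \<Rightarrow> (real \<Rightarrow> real) \<Rightarrow> (real \<Rightarrow> real) \<Rightarrow> real \<Rightarrow> real \<Rightarrow> complex \<Rightarrow> (real \<Rightarrow> complex^3) \<Rightarrow> bool" where
  "is_W1_plus L a b a_plus b_plus l W \<longleftrightarrow>
     crossing_solution L a b l W \<and> (\<exists>x>0. W x \<noteq> 0) \<and>
     (\<lambda>x. norm (W x)) \<in> O[at_top](\<lambda>x. exp (Re (mu3_plus L a_plus b_plus l) * x))"

definition is_W3_minus ::
  "real \<Rightarrow> (real \<Rightarrow> real) \<Rightarrow> (real \<Rightarrow> real) \<Rightarrow> real \<Rightarrow> real \<Rightarrow> complex \<Rightarrow> (real \<Rightarrow> complex^3) \<Rightarrow> bool" where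
  "is_W3_minus L a b a_minus b_minus l W \<longleftrightarrow>
     crossing_solution L a b l W \<and> (\<exists>x<0. W x \<noteq> 0) \<and>
     (\<lambda>x. norm (W x)) \<in> O[at_bot](\<lambda>x. exp (Re (mu3_minus L a_minus b_minus l) * x))"

text \<open>The solution supported on the open half-line \<open>S\<close> (either \<open>{..<0}\<close> or \<open>{0<..}\<close>) that
  vanishes at \<open>0\<close>. The relation \<open>|u| \<sim> |x|\<^sup>\<nu>\<close> is read up to a nonzero constant factor,
  as it has to be for a solution that is only determined up to scaling.\<close>

definition is_W2 ::
  "real \<Rightarrow> (real \<Rightarrow> real) \<Rightarrow> (real \<Rightarrow> real) \<Rightarrow> real set \<Rightarrow> complex \<Rightarrow> (real \<Rightarrow> complex^3) \<Rightarrow> bool" where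
  "is_W2 L a b S l W \<longleftrightarrow>
     (\<forall>x. x \<noteq> 0 \<and> x \<notin> S \<longrightarrow> W x = 0) \<and> (\<exists>x\<in>S. W x \<noteq> 0) \<and>
     solves_eigen_system L a b l W S \<and>
     (W \<longlongrightarrow> 0) (at 0 within S) \<and>
     (\<lambda>x. norm (W x $ 1)) \<in> \<Theta>[at 0 within S](\<lambda>x. \<bar>x\<bar> powr nu_exponent L a b l) \<and>
     (\<lambda>x. norm (W x $ 2)) \<in> O[at 0 within S](\<lambda>x. \<bar>x\<bar> powr nu_exponent L a b l * a x) \<and>
     (\<lambda>x. norm (W x $ 3)) \<in> O[at 0 within S](\<lambda>x. \<bar>x\<bar> powr nu_exponent L a b l * a x)"

definition unstable_region :: "complex set" where
  "unstable_region = {l. Re l \<ge> 0} - {0}"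

text \<open>The families are indexed by the spectral parameter first. Since \<open>unstable_region\<close> is not
  open, \<open>analytic_on\<close> means holomorphic in a neighbourhood of each of its points.\<close>

definition analytic_family :: "(complex \<Rightarrow> real \<Rightarrow> complex^3) \<Rightarrow> bool" where
  "analytic_family W \<longleftrightarrow>
     (\<forall>x i. x \<noteq> 0 \<longrightarrow> (\<lambda>l. W l x $ i) analytic_on unstable_region)"

definition evans_modes ::
  "real \<Rightarrow> (real \<Rightarrow> real) \<Rightarrow> (real \<Rightarrow> real) \<Rightarrow> real \<Rightarrow> real \<Rightarrow> real \<Rightarrow> real \<Rightarrow>
   (complex \<Rightarrow> real \<Rightarrow> complex^3) \<Rightarrow> (complex \<Rightarrow> real \<Rightarrow> complex^3) \<Rightarrow>
   (complex \<Rightarrow> real \<Rightarrow> complex^3) \<Rightarrow> (complex \<Rightarrow> real \<Rightarrow> complex^3) \<Rightarrow> bool" where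
  "evans_modes L a b a_minus b_minus a_plus b_plus W1p W2p W2m W3m \<longleftrightarrow>
     analytic_family W1p \<and> analytic_family W2p \<and> analytic_family W2m \<and> analytic_family W3m \<and>
     (\<forall>l\<in>unstable_region.
        is_W1_plus L a b a_plus b_plus l (W1p l) \<and>
        is_W2 L a b {..<0} l (W2p l) \<and>
        is_W2 L a b {0<..} l (W2m l) \<and>
        is_W3_minus L a b a_minus b_minus l (W3m l))"

text \<open>Determinant with columns \<open>W1 l y\<close>, \<open>W2 l y\<close>, \<open>W3 l y\<close>; \<open>D_plus\<close> is built with the mode
  \<open>W2m\<close> living on the positive half-line, \<open>D_minus\<close> with \<open>W2p\<close> living on the negative one.\<close>

definition evans_det ::
  "(complex \<Rightarrow> real \<Rightarrow> complex^3) \<Rightarrow> (complex \<Rightarrow> real \<Rightarrow> complex^3) \<Rightarrow>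
   (complex \<Rightarrow> real \<Rightarrow> complex^3) \<Rightarrow> real \<Rightarrow> complex \<Rightarrow> complex" where
  "evans_det W1 W2 W3 y l = det (transpose (vector [W1 l y, W2 l y, W3 l y]))"

definition D_plus where
  "D_plus W1p W2m W3m l = evans_det W1p W2m W3m 1 l"

definition D_minus where
  "D_minus W1p W2p W3m l = evans_det W1p W2p W3m (- 1) l"

text \<open>The modes are determined up to nonzero factors, and \<open>W1p\<close> on \<open>x < 0\<close> (resp. \<open>W3m\<close> on
  \<open>x > 0\<close>) up to adding a multiple of \<open>W2p\<close> (resp. \<open>W2m\<close>). This changes \<open>D_plus\<close> and \<open>D_minus\<close>
  by nonvanishing factors only, so the condition is required of every admissible choice.\<close>

definition condition_D ::
  "(real \<Rightarrow> real) \<Rightarrow> (real \<Rightarrow> real) \<Rightarrow> real \<Rightarrow> real \<Rightarrow> real \<Rightarrow> (real \<Rightarrow> real) \<Rightarrow> bool" where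
  "condition_D f M L u_minus u_plus U \<longleftrightarrow>
     (\<forall>W1p W2p W2m W3m.
        evans_modes L (\<lambda>x. deriv f (U x)) (\<lambda>x. deriv M (U x))
          (deriv f u_minus) (deriv M u_minus) (deriv f u_plus) (deriv M u_plus)
          W1p W2p W2m W3m \<longrightarrow>
        (\<forall>l\<in>unstable_region. D_plus W1p W2m W3m l \<noteq> 0 \<and> D_minus W1p W2p W3m l \<noteq> 0))"

end

theory Submission
  imports Defs
begin

text \<open>
  A zero of \<open>D_plus\<close> or \<open>D_minus\<close> makes the three modes linearly dependent, and the dependence glues
  the mode decaying at \<open>-\<infinity>\<close> to the one decaying at \<open>+\<infinity>\<close>: the result is a solution of the
  eigenvalue system that decays at both ends and whose components \<open>q\<close>, \<open>p\<close>, \<open>a u\<close> match at the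
  singular point. The theorem says that no such solution exists for \<open>Re \<lambda> \<ge> 0\<close>, \<open>\<lambda> \<noteq> 0\<close>.

  The argument is an energy estimate. Since \<open>(a u + L q)' = - \<lambda> u\<close>, the function
  \<open>v = - (a u + L q) / \<lambda>\<close> is an antiderivative of \<open>u\<close>. It stays continuous at the singular point,
  where \<open>u\<close> itself need not, and \<open>- p\<close> is an antiderivative of \<open>q\<close>. Multiplying
  \<open>\<lambda> v + a v' - L p' = 0\<close> by the conjugate of \<open>v\<close> and using \<open>b v' = p - p''\<close> gives, for
  \<open>F = a/2 |v|\<^sup>2 - L Re (p v\<^sup>*) + (L/b) Re (p q\<^sup>*)\<close>,
  \<open>- F' = (Re \<lambda> - a'/2) |v|\<^sup>2 + (L/b) (|p|\<^sup>2 + |q|\<^sup>2) + (L b'/b\<^sup>2) Re (p q\<^sup>*)\<close>.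
  The right-hand side is nonnegative, and positive unless \<open>p = q = 0\<close>, as soon as
  \<open>a' \<le> 0\<close>, \<open>L b > 0\<close> and \<open>|b'| < 2 |b|\<close>. As \<open>F\<close> vanishes at both ends, it vanishes identically, and
  so does the solution. This is \<open>no_localized_solution\<close>; working with the pointwise
  monotonicity of \<open>F\<close> rather than with integrals makes any integrability question disappear.

  It remains to verify the hypotheses of the estimate. First, \<open>a' = f''(U) U' \<le> 0\<close> is the
  monotonicity of the profile, \<open>deriv_U_nonpos\<close>: with \<open>R = L Q = f(u_minus) - f(U)\<close> the profile
  equation reads \<open>(a U')' = - R - L b U'\<close>, so that \<open>U'' = - R / a\<close> at a critical point, and its
  sign excludes the extrema which a profile that is not monotone would have. Second,
  \<open>|b'| < 2 |b|\<close> is trivial for constant \<open>b\<close>. For small amplitude it follows from a uniform bound on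
  the slope \<open>z = - U'\<close>, which satisfies \<open>a z' = f''(U) z\<^sup>2 - L b z + R\<close>. At \<open>x = 0\<close> the slope is
  therefore a root of this quadratic; the condition on \<open>L b(0) + (k + 1/2) a'(0)\<close> makes it
  the smaller one, which tends to \<open>0\<close> with the amplitude. A slope reaching a level between the two
  roots could never drop below it further out, which is incompatible with a bounded \<open>U\<close>
  (\<open>slope_bound\<close>). A single \<open>\<epsilon>\<close> serves all end states, because \<open>u_plus\<close> and \<open>u_minus\<close> enclose
  the unique critical point of the convex function \<open>f\<close>. Third, the modes do decay, i.e. the
  eigenvalues \<open>mu3_plus\<close> and \<open>mu3_minus\<close> exist and are unique: existence is a fixed point
  argument, uniqueness comes from the same energy, applied to the system with constant coefficients.
\<close>

section \<open>The energy of a localized solution\<close>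

text \<open>The antiderivative of \<open>u\<close> that decays at the ends: integrate \<open>(a u + L q)' = - \<lambda> u\<close>.\<close>

definition potential :: "real \<Rightarrow> (real \<Rightarrow> real) \<Rightarrow> complex \<Rightarrow> (real \<Rightarrow> complex^3) \<Rightarrow> real \<Rightarrow> complex" where
  "potential L a l W x = - (of_real (a x) * W x $ 1 + of_real L * W x $ 2) / l"

definition energy ::
  "real \<Rightarrow> (real \<Rightarrow> real) \<Rightarrow> (real \<Rightarrow> real) \<Rightarrow> complex \<Rightarrow> (real \<Rightarrow> complex^3) \<Rightarrow> real \<Rightarrow> real" where
  "energy L a b l W x =
     a x / 2 * (potential L a l W x \<bullet> potential L a l W x)
     - L * (W x $ 3 \<bullet> potential L a l W x) + L / b x * (W x $ 3 \<bullet> W x $ 2)"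

definition dissipation ::
  "real \<Rightarrow> (real \<Rightarrow> real) \<Rightarrow> (real \<Rightarrow> real) \<Rightarrow> complex \<Rightarrow> (real \<Rightarrow> complex^3) \<Rightarrow> real \<Rightarrow> real" where
  "dissipation L a b l W x =
     (Re l - deriv a x / 2) * (potential L a l W x \<bullet> potential L a l W x)
     + L / b x * ((norm (W x $ 2))\<^sup>2 + (norm (W x $ 3))\<^sup>2)
     + L * deriv b x / (b x)\<^sup>2 * (W x $ 3 \<bullet> W x $ 2)"

lemma potential_deriv:
  assumes sol: "solves_eigen_system L a b l W S" and x: "x \<in> S" and l: "l \<noteq> 0"
    and a: "a differentiable at x"
  shows "(potential L a l W has_vector_derivative W x $ 1) (at x)"
proof -
  obtain u' where u: "((\<lambda>s. W s $ 1) has_vector_derivative u') (at x)"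
    and au: "of_real (a x) * u' = - (l + of_real (deriv a x) + of_real (L * b x)) * W x $ 1 + of_real L * W x $ 3"
    and q: "((\<lambda>s. W s $ 2) has_vector_derivative (of_real (b x) * W x $ 1 - W x $ 3)) (at x)"
    using sol x unfolding solves_eigen_system_def by blast
  have da': "((\<lambda>s. complex_of_real (a s)) has_vector_derivative of_real (deriv a x)) (at x)"
    using a by (intro has_vector_derivative_of_real) (simp add: DERIV_deriv_iff_real_differentiable)
  have "((\<lambda>s. - (of_real (a s) * W s $ 1 + of_real L * W s $ 2) / l) has_vector_derivative
      - ((of_real (a x) * u' + of_real (deriv a x) * W x $ 1)
        + of_real L * (of_real (b x) * W x $ 1 - W x $ 3)) / l) (at x)"
    by (intro derivative_intros has_vector_derivative_mult da' u q)
  moreover have "- ((of_real (a x) * u' + of_real (deriv a x) * W x $ 1)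
        + of_real L * (of_real (b x) * W x $ 1 - W x $ 3)) / l = W x $ 1"
    unfolding au using l by (simp add: field_simps)
  ultimately show ?thesis unfolding potential_def by simp
qed

text \<open>In the derivative the products \<open>q \<bullet> v\<close> from \<open>a u = - l v - L q\<close> and from \<open>p' = - q\<close> cancel, and so do the
  products \<open>p \<bullet> u\<close> from \<open>v' = u\<close> and from \<open>q' = b u - p\<close>. What remains is quadratic in \<open>v\<close> and in
  \<open>(p, q)\<close>, without coupling between them.\<close>

lemma energy_deriv:
  assumes sol: "solves_eigen_system L a b l W S" and x: "x \<in> S" and l: "l \<noteq> 0"
    and a: "a differentiable at x" and b: "b differentiable at x" and b0: "b x \<noteq> 0"
  shows "(energy L a b l W has_real_derivative - dissipation L a b l W x) (at x)"
proof -
  define v where "v = potential L a l W"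
  define u q p where "u = W x $ 1" and "q = W x $ 2" and "p = W x $ 3"
  have dv: "(v has_vector_derivative u) (at x)"
    unfolding v_def u_def by (rule potential_deriv[OF sol x l a])
  have dq: "((\<lambda>s. W s $ 2) has_vector_derivative (of_real (b x) * u - p)) (at x)"
    and dp: "((\<lambda>s. W s $ 3) has_vector_derivative (- q)) (at x)"
    using sol x unfolding solves_eigen_system_def u_def p_def q_def by blast+
  have da: "(a has_real_derivative deriv a x) (at x)" and db: "(b has_real_derivative deriv b x) (at x)"
    using a b by (simp_all add: DERIV_deriv_iff_real_differentiable)
  have inn: "((\<lambda>s. F s \<bullet> G s) has_real_derivative (F x \<bullet> G' + F' \<bullet> G x)) (at x)"
    if "(F has_vector_derivative F') (at x)" "(G has_vector_derivative G') (at x)"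
    for F G :: "real \<Rightarrow> complex" and F' G'
    using bounded_bilinear.has_vector_derivative[OF bounded_bilinear_inner that]
    by (simp add: has_real_derivative_iff_has_vector_derivative)
  have eq: "of_real (a x) * u = - (l * v x) - of_real L * q"
    using l by (simp add: v_def potential_def u_def q_def)
  have eqR: "a x * Re u = - Re (l * v x) - L * Re q" and eqI: "a x * Im u = - Im (l * v x) - L * Im q"
    using arg_cong[OF eq, of Re] arg_cong[OF eq, of Im] by simp_all
  have au: "a x * (u \<bullet> v x) = - Re l * (v x \<bullet> v x) - L * (q \<bullet> v x)"
  proof -
    have "a x * (u \<bullet> v x) = (a x * Re u) * Re (v x) + (a x * Im u) * Im (v x)"
      by (simp add: inner_complex_def algebra_simps)
    also have "\<dots> = - Re l * (v x \<bullet> v x) - L * (q \<bullet> v x)"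
      unfolding eqR eqI by (simp add: inner_complex_def algebra_simps)
    finally show ?thesis .
  qed
  have 1: "((\<lambda>s. a s / 2 * (v s \<bullet> v s)) has_real_derivative
      deriv a x / 2 * (v x \<bullet> v x) + a x * (u \<bullet> v x)) (at x)"
    by (rule DERIV_cong[OF DERIV_mult[OF DERIV_cdivide[OF da] inn[OF dv dv]]])
       (simp add: inner_commute)
  have 2: "((\<lambda>s. L * (W s $ 3 \<bullet> v s)) has_real_derivative L * (p \<bullet> u - q \<bullet> v x)) (at x)"
    by (rule DERIV_cong[OF DERIV_cmult[OF inn[OF dp dv]]]) (simp add: p_def)
  have db': "((\<lambda>s. L / b s) has_real_derivative - (L * deriv b x / (b x)\<^sup>2)) (at x)"
    using b0 by (auto intro!: derivative_eq_intros db simp: power2_eq_square)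
  have 3: "((\<lambda>s. L / b s * (W s $ 3 \<bullet> W s $ 2)) has_real_derivative
      - (L * deriv b x / (b x)\<^sup>2) * (p \<bullet> q) + L / b x * (b x * (p \<bullet> u) - p \<bullet> p - q \<bullet> q)) (at x)"
  proof (rule DERIV_cong[OF DERIV_mult[OF db' inn[OF dp dq]]])
    have "p \<bullet> (of_real (b x) * u) = b x * (p \<bullet> u)"
      by (simp add: inner_complex_def algebra_simps)
    then show "- (L * deriv b x / (b x)\<^sup>2) * (W x $ 3 \<bullet> W x $ 2) +
      (W x $ 3 \<bullet> (complex_of_real (b x) * u - p) + - q \<bullet> W x $ 2) * (L / b x) =
      - (L * deriv b x / (b x)\<^sup>2) * (p \<bullet> q) + L / b x * (b x * (p \<bullet> u) - p \<bullet> p - q \<bullet> q)"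
      by (simp add: p_def[symmetric] q_def[symmetric] inner_diff_right algebra_simps)
  qed
  have "(energy L a b l W has_real_derivative
     (deriv a x / 2 * (v x \<bullet> v x) + a x * (u \<bullet> v x)) - L * (p \<bullet> u - q \<bullet> v x)
     + (- (L * deriv b x / (b x)\<^sup>2) * (p \<bullet> q) + L / b x * (b x * (p \<bullet> u) - p \<bullet> p - q \<bullet> q))) (at x)"
    unfolding energy_def[abs_def] v_def[symmetric]
    by (intro DERIV_add DERIV_diff 1 2 3)
  moreover have "(deriv a x / 2 * (v x \<bullet> v x) + a x * (u \<bullet> v x)) - L * (p \<bullet> u - q \<bullet> v x)
     + (- (L * deriv b x / (b x)\<^sup>2) * (p \<bullet> q) + L / b x * (b x * (p \<bullet> u) - p \<bullet> p - q \<bullet> q))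
     = - dissipation L a b l W x"
    using b0 unfolding dissipation_def v_def[symmetric] au p_def[symmetric] q_def[symmetric] power2_norm_eq_inner
    by (simp add: right_diff_distrib) (simp add: algebra_simps diff_divide_distrib add_divide_distrib)
  ultimately show ?thesis by simp
qed

text \<open>The mixed term is at most \<open>(L/b) (|b'| / |b|) (|p|\<^sup>2 + |q|\<^sup>2) / 2\<close> by Cauchy-Schwarz, so it is
  absorbed by the middle term when \<open>|b'| < 2 |b|\<close>.\<close>

lemma dissipation_pos:
  assumes l: "Re l \<ge> 0" and a: "deriv a x \<le> 0" and Lb: "L * b x > 0"
    and bsmall: "\<bar>deriv b x\<bar> < 2 * \<bar>b x\<bar>"
  shows "dissipation L a b l W x \<ge> 0"
    and "dissipation L a b l W x = 0 \<Longrightarrow> W x $ 2 = 0 \<and> W x $ 3 = 0"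
proof -
  define r where "r = deriv b x / b x"
  define N where "N = (norm (W x $ 2))\<^sup>2 + (norm (W x $ 3))\<^sup>2"
  have b0: "b x \<noteq> 0" using Lb by auto
  have r: "\<bar>r\<bar> < 2" using bsmall b0 by (simp add: r_def abs_divide divide_simps)
  have Lb': "L / b x > 0" using Lb by (simp add: zero_less_divide_iff zero_less_mult_iff)
  have "\<bar>W x $ 3 \<bullet> W x $ 2\<bar> \<le> norm (W x $ 3) * norm (W x $ 2)" by (rule Cauchy_Schwarz_ineq2)
  also have "\<dots> \<le> N / 2"
    using sum_squares_bound[of "norm (W x $ 3)" "norm (W x $ 2)"] unfolding N_def by simp
  finally have cs: "\<bar>W x $ 3 \<bullet> W x $ 2\<bar> \<le> N / 2" .
  have N0: "N \<ge> 0" by (simp add: N_def)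
  have "\<bar>r * (W x $ 3 \<bullet> W x $ 2)\<bar> \<le> \<bar>r\<bar> * (N / 2)"
    unfolding abs_mult using cs by (intro mult_left_mono) auto
  then have "N + r * (W x $ 3 \<bullet> W x $ 2) \<ge> (1 - \<bar>r\<bar> / 2) * N"
    by (simp add: abs_le_iff algebra_simps)
  then have "L / b x * (N + r * (W x $ 3 \<bullet> W x $ 2)) \<ge> L / b x * ((1 - \<bar>r\<bar> / 2) * N)"
    using Lb' by (intro mult_left_mono) auto
  moreover have "(Re l - deriv a x / 2) * (potential L a l W x \<bullet> potential L a l W x) \<ge> 0"
    using l a by (intro mult_nonneg_nonneg) auto
  moreover have "dissipation L a b l W x = (Re l - deriv a x / 2) * (potential L a l W x \<bullet> potential L a l W x)
      + L / b x * (N + r * (W x $ 3 \<bullet> W x $ 2))"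
    unfolding dissipation_def N_def r_def by (simp add: algebra_simps power2_eq_square)
  ultimately have low: "dissipation L a b l W x \<ge> (L / b x * (1 - \<bar>r\<bar> / 2)) * N" by simp
  have c: "L / b x * (1 - \<bar>r\<bar> / 2) > 0" using Lb' r by (intro mult_pos_pos) auto
  then show "dissipation L a b l W x \<ge> 0" using low N0 by (meson less_imp_le mult_nonneg_nonneg order_trans)
  show "W x $ 2 = 0 \<and> W x $ 3 = 0" if "dissipation L a b l W x = 0"
  proof -
    have "N \<le> 0" using low c unfolding that by (metis mult_le_0_iff not_le)
    then have "(norm (W x $ 2))\<^sup>2 + (norm (W x $ 3))\<^sup>2 = 0" using N0 N_def by linarith
    then show ?thesis by (simp add: sum_power2_eq_zero_iff)
  qed
qed

text \<open>The energy depends on \<open>u\<close> only through \<open>a u\<close>. It therefore has a limit at the singular point,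
  where \<open>a\<close> vanishes and nothing but \<open>a u \<longlongrightarrow> 0\<close> is known about \<open>u\<close>.\<close>

lemma energy_tendsto:
  fixes L :: real and a b :: "real \<Rightarrow> real" and a0 b0 :: real and q0 p0 :: complex
  assumes l: "l \<noteq> 0"
    and u: "((\<lambda>x. of_real (a x) * W x $ 1) \<longlongrightarrow> 0) F"
    and q: "((\<lambda>x. W x $ 2) \<longlongrightarrow> q0) F" and p: "((\<lambda>x. W x $ 3) \<longlongrightarrow> p0) F"
    and a: "(a \<longlongrightarrow> a0) F" and b: "(b \<longlongrightarrow> b0) F" "b0 \<noteq> 0"
  defines "v0 \<equiv> - (of_real L * q0) / l"
  shows "(energy L a b l W \<longlongrightarrow> a0 / 2 * (v0 \<bullet> v0) - L * (p0 \<bullet> v0) + L / b0 * (p0 \<bullet> q0)) F"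
proof -
  have "((\<lambda>x. - (of_real (a x) * W x $ 1 + of_real L * W x $ 2) / l) \<longlongrightarrow> - (0 + of_real L * q0) / l) F"
    using l by (intro tendsto_intros u q)
  then have v: "(potential L a l W \<longlongrightarrow> v0) F"
    unfolding potential_def[abs_def] v0_def by simp
  show ?thesis
    unfolding energy_def[abs_def] by (intro tendsto_intros v q p a b) simp
qed

lemma energy_tendsto_0:
  assumes l: "l \<noteq> 0" and W: "(W \<longlongrightarrow> 0) F" and a: "(a \<longlongrightarrow> a0) F" and b: "(b \<longlongrightarrow> b0) F" "b0 \<noteq> 0"
  shows "(energy L a b l W \<longlongrightarrow> 0) F"
proof -
  have c: "((\<lambda>x. W x $ i) \<longlongrightarrow> 0) F" for i
    using tendsto_vec_nth[OF W, of i] by simp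
  have "((\<lambda>x. of_real (a x) * W x $ 1) \<longlongrightarrow> of_real a0 * 0) F"
    by (intro tendsto_intros a c)
  then have "((\<lambda>x. of_real (a x) * W x $ 1) \<longlongrightarrow> 0) F" by simp
  from energy_tendsto[OF l this c[of 2] c[of 3] a b] show ?thesis by simp
qed

lemma solves_imp_u_zero:
  assumes sol: "solves_eigen_system L a b l W S" and S: "open S" and x: "x \<in> S" and b: "b x \<noteq> 0"
    and qp: "\<And>s. s \<in> S \<Longrightarrow> W s $ 2 = 0 \<and> W s $ 3 = 0"
  shows "W x = 0"
proof -
  have "((\<lambda>s. W s $ 2) has_vector_derivative (of_real (b x) * W x $ 1 - W x $ 3)) (at x)"
    using sol x unfolding solves_eigen_system_def by blast
  moreover have "((\<lambda>s. W s $ 2) has_vector_derivative 0) (at x)"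
    using qp by (intro has_vector_derivative_transform_within_open[OF has_vector_derivative_const S x]) auto
  ultimately have "of_real (b x) * W x $ 1 - W x $ 3 = 0"
    by (rule vector_derivative_unique_at)
  then have "W x $ 1 = 0" using qp[OF x] b by simp
  then show ?thesis using qp[OF x] by (simp add: vec_eq_iff forall_3)
qed

text \<open>The coefficients for which the dissipation is nonnegative everywhere and the energy of a decaying
  solution tends to \<open>0\<close> at both ends. Constant coefficients are included, for use with the limiting
  systems.\<close>

locale damped_coefficients =
  fixes L :: real and a b :: "real \<Rightarrow> real" and a_minus b_minus a_plus b_plus :: real
  assumes a_diff: "\<And>x. a differentiable at x" and b_diff: "\<And>x. b differentiable at x"
    and a_decreasing: "\<And>x. deriv a x \<le> 0"
    and Lb_pos: "\<And>x. L * b x > 0"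
    and b_slow: "\<And>x. \<bar>deriv b x\<bar> < 2 * \<bar>b x\<bar>"
    and a_at_bot: "(a \<longlongrightarrow> a_minus) at_bot" and a_at_top: "(a \<longlongrightarrow> a_plus) at_top"
    and b_at_bot: "(b \<longlongrightarrow> b_minus) at_bot" and b_at_top: "(b \<longlongrightarrow> b_plus) at_top"
    and b_minus: "b_minus \<noteq> 0" and b_plus: "b_plus \<noteq> 0"
begin

lemma b_nonzero: "b x \<noteq> 0"
  using Lb_pos[of x] by auto

lemma energy_antimono:
  assumes sol: "solves_eigen_system L a b l W S" and S: "{s..t} \<subseteq> S"
    and l: "l \<in> unstable_region" and "s \<le> t"
  shows "energy L a b l W t \<le> energy L a b l W s"
proof (rule DERIV_nonpos_imp_nonincreasing[OF \<open>s \<le> t\<close>])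
  fix x assume "s \<le> x" "x \<le> t"
  then have x: "x \<in> S" using S by auto
  have "l \<noteq> 0" "Re l \<ge> 0" using l by (auto simp: unstable_region_def)
  then show "\<exists>y. DERIV (energy L a b l W) x :> y \<and> y \<le> 0"
    using energy_deriv[OF sol x _ a_diff b_diff b_nonzero]
      dissipation_pos(1)[OF _ a_decreasing Lb_pos b_slow] neg_le_0_iff_le by blast
qed

lemma energy_const_imp_zero:
  assumes sol: "solves_eigen_system L a b l W S" and S: "open S" and x: "x \<in> S"
    and l: "l \<in> unstable_region" and E: "\<And>s. s \<in> S \<Longrightarrow> energy L a b l W s = 0"
  shows "W x = 0"
proof (rule solves_imp_u_zero[OF sol S x b_nonzero])
  fix s assume s: "s \<in> S"
  have l': "l \<noteq> 0" "Re l \<ge> 0" using l by (auto simp: unstable_region_def)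
  have "(energy L a b l W has_real_derivative 0) (at s)"
    by (rule has_field_derivative_transform_within_open[OF DERIV_const S s]) (simp add: E)
  then have "dissipation L a b l W s = 0"
    using energy_deriv[OF sol s l'(1) a_diff b_diff b_nonzero] DERIV_unique by fastforce
  then show "W s $ 2 = 0 \<and> W s $ 3 = 0"
    by (rule dissipation_pos(2)[OF l'(2) a_decreasing Lb_pos b_slow])
qed

lemma energy_nonneg_right:
  assumes sol: "solves_eigen_system L a b l W {s<..}" and l: "l \<in> unstable_region"
    and W: "(W \<longlongrightarrow> 0) at_top" and x: "s < x"
  shows "energy L a b l W x \<ge> 0"
proof (rule tendsto_upperbound[OF _ _ trivial_limit_at_top_linorder])
  show "(energy L a b l W \<longlongrightarrow> 0) at_top"
    using l by (intro energy_tendsto_0[OF _ W a_at_top b_at_top b_plus]) (auto simp: unstable_region_def)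
  have "energy L a b l W r \<le> energy L a b l W x" if "x \<le> r" for r
    using x by (intro energy_antimono[OF sol _ l that]) auto
  then show "eventually (\<lambda>r. energy L a b l W r \<le> energy L a b l W x) at_top"
    by (rule eventually_at_top_linorderI)
qed

lemma energy_nonpos_left:
  assumes sol: "solves_eigen_system L a b l W {..<s}" and l: "l \<in> unstable_region"
    and W: "(W \<longlongrightarrow> 0) at_bot" and x: "x < s"
  shows "energy L a b l W x \<le> 0"
proof (rule tendsto_lowerbound[OF _ _ trivial_limit_at_bot_linorder])
  show "(energy L a b l W \<longlongrightarrow> 0) at_bot"
    using l by (intro energy_tendsto_0[OF _ W a_at_bot b_at_bot b_minus]) (auto simp: unstable_region_def)
  have "energy L a b l W x \<le> energy L a b l W r" if "r \<le> x" for r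
    using x by (intro energy_antimono[OF sol _ l that]) auto
  then show "eventually (\<lambda>r. energy L a b l W x \<le> energy L a b l W r) at_bot"
    unfolding eventually_at_bot_linorder by blast
qed

text \<open>The energy decreases on each half-line and tends to \<open>0\<close> at the ends. Hence it is \<open>\<le> 0\<close> on the
  left and \<open>\<ge> 0\<close> on the right; the common limit at \<open>0\<close> is then \<open>0\<close>, and monotonicity forces the
  energy to be constant on both sides.\<close>

lemma no_localized_solution:
  assumes solm: "solves_eigen_system L a b l W {..<0}" and solp: "solves_eigen_system L a b l W {0<..}"
    and l: "l \<in> unstable_region"
    and u: "((\<lambda>x. of_real (a x) * W x $ 1) \<longlongrightarrow> 0) (at 0)"
    and q: "((\<lambda>x. W x $ 2) \<longlongrightarrow> q0) (at 0)" and p: "((\<lambda>x. W x $ 3) \<longlongrightarrow> p0) (at 0)"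
    and bot: "(W \<longlongrightarrow> 0) at_bot" and top: "(W \<longlongrightarrow> 0) at_top" and x: "x \<noteq> 0"
  shows "W x = 0"
proof -
  let ?E = "energy L a b l W"
  have l0: "l \<noteq> 0" using l by (auto simp: unstable_region_def)
  have "isCont a 0" "isCont b 0"
    using a_diff b_diff by (auto intro: differentiable_imp_continuous_within)
  then have ab: "(a \<longlongrightarrow> a 0) (at 0)" "(b \<longlongrightarrow> b 0) (at 0)" by (auto simp: isCont_def)
  obtain E0 where E0: "(?E \<longlongrightarrow> E0) (at 0)"
    using energy_tendsto[OF l0 u q p ab b_nonzero] by blast
  have l_lim: "(?E \<longlongrightarrow> E0) (at_left 0)" and r_lim: "(?E \<longlongrightarrow> E0) (at_right 0)"
    using E0 by (auto intro: tendsto_within_subset)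
  have "E0 \<le> 0"
    by (rule tendsto_upperbound[OF l_lim])
       (auto intro!: always_eventually energy_nonpos_left[OF solm l bot] simp: eventually_at_filter)
  moreover have "E0 \<ge> 0"
    by (rule tendsto_lowerbound[OF r_lim])
       (auto intro!: always_eventually energy_nonneg_right[OF solp l top] simp: eventually_at_filter)
  ultimately have E00: "E0 = 0" by simp
  have Er: "?E s = 0" if s: "s \<in> {0<..}" for s
  proof (rule antisym)
    have "eventually (\<lambda>r. ?E s \<le> ?E r) (at_right 0)"
      using s by (auto simp: eventually_at_right intro!: exI[of _ s] energy_antimono[OF solp _ l])
    then show "?E s \<le> 0" using tendsto_lowerbound[OF r_lim] E00 by auto
    show "0 \<le> ?E s" using energy_nonneg_right[OF solp l top] s by auto
  qed
  have El: "?E s = 0" if s: "s \<in> {..<0}" for s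
  proof (rule antisym)
    have "eventually (\<lambda>r. ?E r \<le> ?E s) (at_left 0)"
      using s by (auto simp: eventually_at_left intro!: exI[of _ s] energy_antimono[OF solm _ l])
    then show "0 \<le> ?E s" using tendsto_upperbound[OF l_lim] E00 by auto
    show "?E s \<le> 0" using energy_nonpos_left[OF solm l bot] s by auto
  qed
  show ?thesis
  proof (cases "x < 0")
    case True then show ?thesis
      using energy_const_imp_zero[OF solm _ _ l El] by simp
  next
    case False then show ?thesis
      using energy_const_imp_zero[OF solp _ _ l Er] x by simp
  qed
qed

end

section \<open>Eigenvalues of the limiting systems\<close>

text \<open>Eliminating \<open>q = - m p\<close> and \<open>b u = (1 - m\<^sup>2) p\<close> from the eigenvector equations leaves this cubic
  equation, which is invariant under \<open>(a, m) \<mapsto> (- a, - m)\<close>.\<close>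

lemma is_eigenvalue_limit_matrix:
  assumes a: "a \<noteq> 0" and b: "b \<noteq> 0"
  shows "is_eigenvalue (limit_matrix L a b l) m \<longleftrightarrow>
    (of_real a * m + l + of_real (L * b)) * (1 - m\<^sup>2) = of_real (L * b)"
proof -
  let ?a = "complex_of_real a" and ?b = "complex_of_real b" and ?L = "complex_of_real L"
  have sys: "limit_matrix L a b l *v v = m *s v \<longleftrightarrow>
     ?L * v $ 3 = (?a * m + l + ?L * ?b) * v $ 1 \<and> ?b * v $ 1 - v $ 3 = m * v $ 2 \<and> - v $ 2 = m * v $ 3" for v
  proof -
    have rows: "(limit_matrix L a b l *v v) $ 1 = - (l + ?L * ?b) / ?a * v $ 1 + ?L / ?a * v $ 3"
      "(limit_matrix L a b l *v v) $ 2 = ?b * v $ 1 - v $ 3" "(limit_matrix L a b l *v v) $ 3 = - v $ 2"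
      by (simp_all add: limit_matrix_def matrix_vector_mult_def sum_3 vector_3)
    have "- (l + ?L * ?b) / ?a * v $ 1 + ?L / ?a * v $ 3 = (- (l + ?L * ?b) * v $ 1 + ?L * v $ 3) / ?a"
      by (simp only: add_divide_distrib times_divide_eq_left)
    then have "- (l + ?L * ?b) / ?a * v $ 1 + ?L / ?a * v $ 3 = m * v $ 1
        \<longleftrightarrow> - (l + ?L * ?b) * v $ 1 + ?L * v $ 3 = m * v $ 1 * ?a"
      using a by (simp only: divide_eq_eq) simp
    also have "\<dots> \<longleftrightarrow> ?L * v $ 3 = (?a * m + l + ?L * ?b) * v $ 1"
      by (auto simp: algebra_simps)
    finally show ?thesis by (simp only: vec_eq_iff forall_3 rows vector_smult_component)
  qed
  show ?thesis
  proof
    assume "is_eigenvalue (limit_matrix L a b l) m"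
    then obtain v where v: "v \<noteq> 0" and ev: "limit_matrix L a b l *v v = m *s v"
      unfolding is_eigenvalue_def by blast
    have e: "?L * v $ 3 = (?a * m + l + ?L * ?b) * v $ 1" "?b * v $ 1 - v $ 3 = m * v $ 2" "- v $ 2 = m * v $ 3"
      using ev unfolding sys by simp_all
    have 2: "v $ 2 = - (m * v $ 3)" using arg_cong[OF e(3), of uminus] by simp
    have "?b * v $ 1 = v $ 3 + m * v $ 2" using e(2) by (simp only: diff_eq_eq add.commute)
    also have "\<dots> = (1 - m\<^sup>2) * v $ 3" unfolding 2 by (simp add: algebra_simps power2_eq_square)
    finally have 1: "?b * v $ 1 = (1 - m\<^sup>2) * v $ 3" .
    have "v $ 3 \<noteq> 0"
    proof
      assume "v $ 3 = 0"
      then have "v $ 1 = 0" "v $ 2 = 0" "v $ 3 = 0" using 1 2 b by auto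
      then show False using v by (simp add: vec_eq_iff forall_3)
    qed
    moreover have "((?a * m + l + ?L * ?b) * (1 - m\<^sup>2)) * v $ 3 = (?L * ?b) * v $ 3"
    proof -
      have "((?a * m + l + ?L * ?b) * (1 - m\<^sup>2)) * v $ 3 = (?a * m + l + ?L * ?b) * (?b * v $ 1)"
        unfolding 1 by (rule mult.assoc)
      also have "\<dots> = ?b * (?L * v $ 3)" unfolding e(1) by (rule mult.left_commute)
      finally show ?thesis by (simp only: ac_simps)
    qed
    ultimately show "(?a * m + l + of_real (L * b)) * (1 - m\<^sup>2) = of_real (L * b)" by simp
  next
    assume h: "(?a * m + l + of_real (L * b)) * (1 - m\<^sup>2) = of_real (L * b)"
    define v :: "complex^3" where "v = vector [(1 - m\<^sup>2) / ?b, - m, 1]"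
    have vc: "v $ 1 = (1 - m\<^sup>2) / ?b" "v $ 2 = - m" "v $ 3 = 1" by (simp_all add: v_def vector_3)
    have "v \<noteq> 0" using vc(3) by (metis zero_index zero_neq_one)
    moreover have "limit_matrix L a b l *v v = m *s v"
    proof -
      have "(?a * m + l + ?L * ?b) * ((1 - m\<^sup>2) / ?b) = ((?a * m + l + of_real (L * b)) * (1 - m\<^sup>2)) / ?b" by simp
      also have "\<dots> = ?L" unfolding h using b by simp
      finally show ?thesis unfolding sys vc using b by (simp add: power2_eq_square)
    qed
    ultimately show "is_eigenvalue (limit_matrix L a b l) m" unfolding is_eigenvalue_def by blast
  qed
qed

text \<open>The fixed point argument below also meets the branch point \<open>0\<close>, at the boundary of the half-plane.\<close>

lemma continuous_on_csqrt_right_half_plane: "continuous_on {z. Re z \<ge> 0} csqrt"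
  unfolding continuous_on_eq_continuous_within
proof
  fix z assume z: "z \<in> {z. Re z \<ge> 0}"
  show "continuous (at z within {z. Re z \<ge> 0}) csqrt"
  proof (cases "z = 0")
    case True
    have "((\<lambda>w. norm (csqrt w)) \<longlongrightarrow> sqrt (norm (0::complex))) (at 0 within {z. Re z \<ge> 0})"
      unfolding norm_csqrt by (intro tendsto_intros)
    then have "((\<lambda>w. norm (csqrt w)) \<longlongrightarrow> 0) (at 0 within {z. Re z \<ge> 0})" by simp
    then have "(csqrt \<longlongrightarrow> 0) (at 0 within {z. Re z \<ge> 0})" by (rule tendsto_norm_zero_cancel)
    then show ?thesis by (simp add: True continuous_within)
  next
    case False
    then have "z \<notin> \<real>\<^sub>\<le>\<^sub>0" using z by (auto simp: complex_nonpos_Reals_iff complex_eq_iff)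
    then show ?thesis by (rule continuous_within_csqrt)
  qed
qed

text \<open>With \<open>m\<close> replaced by \<open>- m\<close> the equation becomes the fixed point problem
  \<open>m = csqrt (1 - \<beta> / (\<bar>a\<bar> m + l + \<beta>))\<close>. For \<open>Re m \<ge> 0\<close> the denominator has real part at least
  \<open>\<beta>\<close>, so the quotient has modulus at most 1: the right-hand side is continuous and maps a half-disc
  into itself, and Brouwer's theorem applies. A fixed point on the imaginary axis would force
  \<open>l = 0\<close>.\<close>

lemma stable_root_exists:
  fixes a \<beta> :: real
  assumes a: "a < 0" and \<beta>: "\<beta> > 0" and l: "l \<in> unstable_region"
  shows "\<exists>m. Re m < 0 \<and> (of_real a * m + l + of_real \<beta>) * (1 - m\<^sup>2) = of_real \<beta>"
proof -
  have l0: "l \<noteq> 0" and Rl: "Re l \<ge> 0" using l by (auto simp: unstable_region_def)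
  define d where "d = (\<lambda>m. l + of_real \<beta> - of_real a * m)"
  define T where "T = (\<lambda>m. csqrt (1 - of_real \<beta> / d m))"
  define S where "S = {z. Re z \<ge> 0} \<inter> cball (0::complex) 2"
  have Rd: "Re (d m) \<ge> \<beta>" if "Re m \<ge> 0" for m
    using mult_nonpos_nonneg[OF less_imp_le[OF a] that] Rl by (simp add: d_def)
  have nd: "norm (of_real \<beta> / d m) \<le> 1" if "Re m \<ge> 0" for m
    using Rd[OF that] \<beta> complex_Re_le_cmod[of "d m"] by (simp add: norm_divide divide_le_eq_1)
  have d0: "d m \<noteq> 0" if "Re m \<ge> 0" for m using Rd[OF that] \<beta> by auto
  have "compact S" unfolding S_def
    by (intro closed_Int_compact closed_halfspace_Re_ge compact_cball)
  moreover have "convex S" unfolding S_def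
    by (intro convex_Int convex_cball convex_halfspace_Re_ge)
  moreover have "0 \<in> S" by (simp add: S_def)
  moreover have "continuous_on S T"
    unfolding T_def
  proof (rule continuous_on_compose2[OF continuous_on_csqrt_right_half_plane])
    show "continuous_on S (\<lambda>m. 1 - of_real \<beta> / d m)"
      using d0 unfolding d_def S_def by (intro continuous_intros) auto
    show "(\<lambda>m. 1 - of_real \<beta> / d m) ` S \<subseteq> {z. 0 \<le> Re z}"
    proof clarify
      fix m assume "m \<in> S"
      then show "0 \<le> Re (1 - of_real \<beta> / d m)"
        using nd[of m] complex_Re_le_cmod[of "of_real \<beta> / d m"] by (simp add: S_def)
    qed
  qed
  moreover have "T \<in> S \<rightarrow> S"
  proof
    fix m assume m: "m \<in> S"
    have "norm (1 - of_real \<beta> / d m) \<le> 1 + 1"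
      using nd[of m] m by (intro norm_triangle_le_diff) (auto simp: S_def)
    then have "norm (T m) \<le> 2" unfolding T_def norm_csqrt by (intro real_le_lsqrt) auto
    moreover have "0 \<le> Re (T m)" unfolding T_def by (rule Re_csqrt)
    ultimately show "T m \<in> S" by (simp add: S_def)
  qed
  ultimately obtain m where m: "m \<in> S" "T m = m" using brouwer[of S T] by blast
  have Rm: "Re m \<ge> 0" using m by (simp add: S_def)
  have "m\<^sup>2 = 1 - of_real \<beta> / d m" using m(2) power2_csqrt unfolding T_def by metis
  then have root: "d m * (1 - m\<^sup>2) = of_real \<beta>" using d0[OF Rm] by simp
  have "Re m \<noteq> 0"
  proof
    assume R0: "Re m = 0"
    then have m2: "1 - m\<^sup>2 = of_real (1 + (Im m)\<^sup>2)" by (simp add: complex_eq_iff power2_eq_square)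
    have "Re (d m) * (1 + (Im m)\<^sup>2) = \<beta>" and I: "Im (d m) * (1 + (Im m)\<^sup>2) = 0"
      using root unfolding m2 by (auto simp: complex_eq_iff)
    then have "(Re l + \<beta>) * (1 + (Im m)\<^sup>2) = \<beta>" using R0 by (simp add: d_def)
    then have sum0: "Re l * (1 + (Im m)\<^sup>2) + \<beta> * (Im m)\<^sup>2 = 0" by (simp add: algebra_simps)
    moreover have "Re l * (1 + (Im m)\<^sup>2) \<ge> 0" "\<beta> * (Im m)\<^sup>2 \<ge> 0" using Rl \<beta> by auto
    ultimately have "\<beta> * (Im m)\<^sup>2 = 0" "Re l * (1 + (Im m)\<^sup>2) = 0" by linarith+
    then have im: "Im m = 0" "Re l = 0" using \<beta> by auto
    then have "Im l = 0" using I by (simp add: d_def)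
    then show False using im l0 by (simp add: complex_eq_iff)
  qed
  then have "Re (- m) < 0" using Rm by simp
  moreover have "(of_real a * (- m) + l + of_real \<beta>) * (1 - (- m)\<^sup>2) = of_real \<beta>"
    using root by (simp add: d_def algebra_simps)
  ultimately show ?thesis by blast
qed

text \<open>The solution \<open>e\<^sup>m\<^sup>x\<close> times an eigenvector of the limiting system with constant coefficients,
  scaled so that \<open>p(0) = 1\<close>.\<close>

definition exp_mode :: "real \<Rightarrow> complex \<Rightarrow> real \<Rightarrow> complex^3" where
  "exp_mode b m x = exp (of_real x * m) *s vector [(1 - m\<^sup>2) / of_real b, - m, 1]"

lemma exp_mode_nth:
  "exp_mode b m x $ 1 = exp (of_real x * m) * ((1 - m\<^sup>2) / of_real b)"
  "exp_mode b m x $ 2 = exp (of_real x * m) * (- m)"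
  "exp_mode b m x $ 3 = exp (of_real x * m)"
  by (simp_all add: exp_mode_def vector_3)

lemma exp_vector_derivative:
  "((\<lambda>x. exp (of_real x * m) * c) has_vector_derivative (m * (exp (of_real x * m) * c))) (at x)"
  for m c :: complex
proof -
  have "((\<lambda>z. exp (z * m) * c) has_field_derivative (m * (exp (of_real x * m) * c))) (at (of_real x))"
    by (auto intro!: derivative_eq_intros)
  then show ?thesis by (rule has_vector_derivative_real_field)
qed

lemma exp_mode_solves:
  assumes b: "b \<noteq> 0" and m: "(of_real a * m + l + of_real (L * b)) * (1 - m\<^sup>2) = of_real (L * b)"
  shows "solves_eigen_system L (\<lambda>_. a) (\<lambda>_. b) l (exp_mode b m) S"
  unfolding solves_eigen_system_def
proof (intro ballI conjI exI)
  fix x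
  let ?e = "exp (of_real x * m)"
  let ?u' = "m * (?e * ((1 - m\<^sup>2) / of_real b))"
  show "((\<lambda>s. exp_mode b m s $ 1) has_vector_derivative ?u') (at x)"
    unfolding exp_mode_nth by (rule exp_vector_derivative)
  have "of_real a * m * (1 - m\<^sup>2) = - (l + of_real (L * b)) * (1 - m\<^sup>2) + of_real (L * b)"
    using m by (simp add: algebra_simps)
  then have "(of_real a * m * (1 - m\<^sup>2)) * (?e / of_real b)
     = (- (l + of_real (L * b)) * (1 - m\<^sup>2) + of_real (L * b)) * (?e / of_real b)" by simp
  then show "of_real a * ?u' = - (l + of_real (deriv (\<lambda>_. a) x) + of_real (L * b)) * exp_mode b m x $ 1
     + of_real L * exp_mode b m x $ 3"
    unfolding exp_mode_nth using b by (simp add: field_simps)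
  show "((\<lambda>s. exp_mode b m s $ 2) has_vector_derivative
     (of_real b * exp_mode b m x $ 1 - exp_mode b m x $ 3)) (at x)"
    unfolding exp_mode_nth
    by (rule has_vector_derivative_eq_rhs[OF exp_vector_derivative])
       (use b in \<open>simp add: field_simps power2_eq_square\<close>)
  show "((\<lambda>s. exp_mode b m s $ 3) has_vector_derivative - exp_mode b m x $ 2) (at x)"
    unfolding exp_mode_nth
    using exp_vector_derivative[of m 1 x] by (simp add: mult.commute)
qed

lemma solves_eigen_system_lincomb:
  assumes "solves_eigen_system L a b l W S" "solves_eigen_system L a b l V S"
  shows "solves_eigen_system L a b l (\<lambda>x. c *s W x + d *s V x) S"
  unfolding solves_eigen_system_def
proof (intro ballI conjI)
  fix x assume x: "x \<in> S"
  obtain u' v' where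
    u: "((\<lambda>s. W s $ 1) has_vector_derivative u') (at x)"
       "of_real (a x) * u' = - (l + of_real (deriv a x) + of_real (L * b x)) * W x $ 1 + of_real L * W x $ 3"
    and v: "((\<lambda>s. V s $ 1) has_vector_derivative v') (at x)"
       "of_real (a x) * v' = - (l + of_real (deriv a x) + of_real (L * b x)) * V x $ 1 + of_real L * V x $ 3"
    and q: "((\<lambda>s. W s $ 2) has_vector_derivative (of_real (b x) * W x $ 1 - W x $ 3)) (at x)"
       "((\<lambda>s. V s $ 2) has_vector_derivative (of_real (b x) * V x $ 1 - V x $ 3)) (at x)"
    and p: "((\<lambda>s. W s $ 3) has_vector_derivative (- W x $ 2)) (at x)"
       "((\<lambda>s. V s $ 3) has_vector_derivative (- V x $ 2)) (at x)"
    using assms x unfolding solves_eigen_system_def by meson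
  have lin: "((\<lambda>s. (c *s W s + d *s V s) $ i) has_vector_derivative c * f + d * g) (at x)"
    if "((\<lambda>s. W s $ i) has_vector_derivative f) (at x)" "((\<lambda>s. V s $ i) has_vector_derivative g) (at x)"
    for i f g
    using has_vector_derivative_add[OF has_vector_derivative_mult_right[OF that(1)]
        has_vector_derivative_mult_right[OF that(2)]] by simp
  have "of_real (a x) * (c * u' + d * v') = c * (of_real (a x) * u') + d * (of_real (a x) * v')"
    by (simp add: algebra_simps)
  also have "\<dots> = - (l + of_real (deriv a x) + of_real (L * b x)) * (c *s W x + d *s V x) $ 1
      + of_real L * (c *s W x + d *s V x) $ 3"
    unfolding u v by (simp add: algebra_simps)
  finally show "\<exists>u'. ((\<lambda>s. (c *s W s + d *s V s) $ 1) has_vector_derivative u') (at x) \<and>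
    of_real (a x) * u' = - (l + of_real (deriv a x) + of_real (L * b x)) * (c *s W x + d *s V x) $ 1
      + of_real L * (c *s W x + d *s V x) $ 3"
    using lin[OF u(1) v(1)] by blast
  show "((\<lambda>s. (c *s W s + d *s V s) $ 2) has_vector_derivative
      of_real (b x) * (c *s W x + d *s V x) $ 1 - (c *s W x + d *s V x) $ 3) (at x)"
    by (rule has_vector_derivative_eq_rhs[OF lin[OF q]]) (simp add: algebra_simps)
  show "((\<lambda>s. (c *s W s + d *s V s) $ 3) has_vector_derivative - (c *s W x + d *s V x) $ 2) (at x)"
    by (rule has_vector_derivative_eq_rhs[OF lin[OF p]]) (simp add: algebra_simps)
qed

lemma exp_mode_tendsto_0:
  assumes "Re m < 0"
  shows "(exp_mode b m \<longlongrightarrow> 0) at_top"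
proof -
  have "((\<lambda>x. exp (Re m * x)) \<longlongrightarrow> 0) at_top"
    using assms by (intro filterlim_compose[OF exp_at_bot] filterlim_tendsto_neg_mult_at_bot[OF tendsto_const]) (auto simp: filterlim_ident)
  then have "((\<lambda>x. norm (exp (complex_of_real x * m))) \<longlongrightarrow> 0) at_top"
    by (simp add: mult.commute)
  then have e: "((\<lambda>x. exp (complex_of_real x * m)) \<longlongrightarrow> 0) at_top" by (rule tendsto_norm_zero_cancel)
  show ?thesis
  proof (rule vec_tendstoI)
    fix i :: 3
    have "((\<lambda>x. exp (complex_of_real x * m) * (vector [(1 - m\<^sup>2) / of_real b, - m, 1] :: complex^3) $ i) \<longlongrightarrow>
       0 * (vector [(1 - m\<^sup>2) / of_real b, - m, 1] :: complex^3) $ i) at_top"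
      by (intro tendsto_intros e)
    then show "((\<lambda>x. exp_mode b m x $ i) \<longlongrightarrow> 0 $ i) at_top" by (simp add: exp_mode_def)
  qed
qed

text \<open>The difference of the two exponential solutions decays at \<open>+\<infinity>\<close> and has \<open>p(0) = 0\<close>. At \<open>x = 0\<close>
  its energy is therefore \<open>a/2 |v|\<^sup>2 \<le> 0\<close>, whereas the decay makes it nonnegative for all \<open>x\<close>.
  So the energy, and with it the difference, vanishes for \<open>x > 0\<close>.\<close>

lemma stable_root_unique:
  fixes a b L :: real
  assumes a: "a < 0" and Lb: "L * b > 0" and l: "l \<in> unstable_region"
    and m: "Re m < 0" "(of_real a * m + l + of_real (L * b)) * (1 - m\<^sup>2) = of_real (L * b)"
    and n: "Re n < 0" "(of_real a * n + l + of_real (L * b)) * (1 - n\<^sup>2) = of_real (L * b)"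
  shows "m = n"
proof -
  have b0: "b \<noteq> 0" using Lb by auto
  interpret damped_coefficients L "\<lambda>_. a" "\<lambda>_. b" a b a b
    by unfold_locales (use Lb b0 in auto)
  define W where "W = (\<lambda>x. 1 *s exp_mode b m x + (- 1) *s exp_mode b n x)"
  have sol: "solves_eigen_system L (\<lambda>_. a) (\<lambda>_. b) l W S" for S
    unfolding W_def by (intro solves_eigen_system_lincomb exp_mode_solves b0 m n)
  have "((\<lambda>x. exp_mode b m x - exp_mode b n x) \<longlongrightarrow> 0 - 0) at_top"
    by (intro tendsto_diff exp_mode_tendsto_0 m n)
  then have W: "(W \<longlongrightarrow> 0) at_top" by (simp add: W_def)
  have "W 0 $ 3 = 0" by (simp add: W_def exp_mode_nth)
  then have E0: "energy L (\<lambda>_. a) (\<lambda>_. b) l W 0 \<le> 0"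
    using a by (simp add: energy_def mult_nonpos_nonneg)
  have E: "energy L (\<lambda>_. a) (\<lambda>_. b) l W s = 0" if "s \<in> {0<..}" for s
    using energy_nonneg_right[OF sol l W, of "-1" s] energy_antimono[OF sol[of UNIV] _ l, of 0 s] E0 that by auto
  have W0: "W x = 0" if "x > 0" for x
    by (rule energy_const_imp_zero[OF sol[of "{0<..}"] _ _ l E]) (use that in auto)
  have "W 1 $ 2 = 0" "W 1 $ 3 = 0" using W0[of 1] by simp_all
  then show ?thesis by (simp add: W_def exp_mode_nth)
qed

lemma mu3_plus_neg:
  assumes a: "a < 0" and Lb: "L * b > 0" and l: "l \<in> unstable_region"
  shows "Re (mu3_plus L a b l) < 0"
proof -
  have ab: "a \<noteq> 0" "b \<noteq> 0" using a Lb by auto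
  have "\<exists>!m. is_eigenvalue (limit_matrix L a b l) m \<and> Re m < 0"
    unfolding is_eigenvalue_limit_matrix[OF ab]
    using stable_root_exists[OF a Lb l] stable_root_unique[OF a Lb l] by blast
  from theI'[OF this] show ?thesis unfolding mu3_plus_def by blast
qed

lemma mu3_minus_pos:
  assumes a: "a > 0" and Lb: "L * b > 0" and l: "l \<in> unstable_region"
  shows "Re (mu3_minus L a b l) > 0"
proof -
  have ab: "a \<noteq> 0" "- a \<noteq> 0" "b \<noteq> 0" and a': "- a < 0" using a Lb by auto
  have flip: "is_eigenvalue (limit_matrix L a b l) m \<longleftrightarrow> is_eigenvalue (limit_matrix L (- a) b l) (- m)" for m
    unfolding is_eigenvalue_limit_matrix[OF ab(1,3)] is_eigenvalue_limit_matrix[OF ab(2,3)] by simp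
  have ex: "\<exists>!m. is_eigenvalue (limit_matrix L (- a) b l) m \<and> Re m < 0"
    unfolding is_eigenvalue_limit_matrix[OF ab(2,3)]
    using stable_root_exists[OF a' Lb l] stable_root_unique[OF a' Lb l] by blast
  have "\<exists>!m. is_eigenvalue (limit_matrix L a b l) m \<and> Re m > 0"
  proof -
    obtain n where n: "is_eigenvalue (limit_matrix L (- a) b l) n" "Re n < 0" using ex by blast
    show ?thesis
    proof (rule ex1I[of _ "- n"])
      show "is_eigenvalue (limit_matrix L a b l) (- n) \<and> 0 < Re (- n)" using n flip[of "- n"] by simp
      fix m assume "is_eigenvalue (limit_matrix L a b l) m \<and> 0 < Re m"
      then have "is_eigenvalue (limit_matrix L (- a) b l) (- m) \<and> Re (- m) < 0" using flip by simp
      then have "- m = n" using ex n by blast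
      then show "m = - n" by auto
    qed
  qed
  from theI'[OF this] show ?thesis unfolding mu3_minus_def by blast
qed

section \<open>Uniqueness for the initial value problem\<close>

lemma gronwall_zero:
  fixes N N' :: "real \<Rightarrow> real"
  assumes "\<And>x. x \<in> closed_segment y z \<Longrightarrow> (N has_real_derivative N' x) (at x)"
    and "\<And>x. x \<in> closed_segment y z \<Longrightarrow> \<bar>N' x\<bar> \<le> K * N x"
    and "N y = 0" and "N z \<ge> 0"
  shows "N z = 0"
proof (cases "y \<le> z")
  case True
  then have seg: "closed_segment y z = {y..z}" by (simp add: closed_segment_eq_real_ivl)
  have "exp (- K * z) * N z \<le> exp (- K * y) * N y"
  proof (rule DERIV_nonpos_imp_nonincreasing[OF True])
    fix x assume x: "y \<le> x" "x \<le> z"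
    have "((\<lambda>x. exp (- K * x) * N x) has_real_derivative exp (- K * x) * (N' x - K * N x)) (at x)"
      using assms(1)[of x] x seg by (auto intro!: derivative_eq_intros simp: algebra_simps)
    moreover have "exp (- K * x) * (N' x - K * N x) \<le> 0"
      using assms(2)[of x] x seg by (intro mult_nonneg_nonpos) auto
    ultimately show "\<exists>d. ((\<lambda>x. exp (- K * x) * N x) has_real_derivative d) (at x) \<and> d \<le> 0" by blast
  qed
  then show ?thesis using assms(3,4) by (simp add: mult_le_0_iff)
next
  case False
  then have seg: "closed_segment y z = {z..y}" by (simp add: closed_segment_eq_real_ivl)
  have "exp (K * z) * N z \<le> exp (K * y) * N y"
  proof (rule DERIV_nonneg_imp_nondecreasing[of z y])
    fix x assume x: "z \<le> x" "x \<le> y"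
    have "((\<lambda>x. exp (K * x) * N x) has_real_derivative exp (K * x) * (N' x + K * N x)) (at x)"
      using assms(1)[of x] x seg by (auto intro!: derivative_eq_intros simp: algebra_simps)
    moreover have "exp (K * x) * (N' x + K * N x) \<ge> 0"
      using assms(2)[of x] x seg by (intro mult_nonneg_nonneg) (auto simp: abs_le_iff)
    ultimately show "\<exists>d. ((\<lambda>x. exp (K * x) * N x) has_real_derivative d) (at x) \<and> 0 \<le> d" by blast
  qed (use False in simp)
  then show ?thesis using assms(3,4) by (simp add: mult_le_0_iff)
qed

text \<open>The growth rate of \<open>|W|\<^sup>2\<close> along a solution, when \<open>r\<close>, \<open>s\<close>, \<open>t\<close> are the moduli of \<open>u\<close>, \<open>q\<close>,
  \<open>p\<close> and \<open>C\<close> bounds the coefficients.\<close>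

lemma quadratic_growth_bound:
  fixes C r s t :: real
  assumes "C \<ge> 0"
  shows "2 * (r * (C * r + C * t) + s * (C * r + t) + t * s) \<le> (4 * (C + 1) + 2) * (r\<^sup>2 + s\<^sup>2 + t\<^sup>2)"
proof -
  have "0 \<le> C * (r - t)\<^sup>2 + C * (r - s)\<^sup>2 + 2 * (s - t)\<^sup>2 + C * (3 * s\<^sup>2 + 3 * t\<^sup>2)
      + (6 * r\<^sup>2 + 4 * s\<^sup>2 + 4 * t\<^sup>2)"
    using assms by (intro add_nonneg_nonneg mult_nonneg_nonneg) auto
  also have "\<dots> = (4 * (C + 1) + 2) * (r\<^sup>2 + s\<^sup>2 + t\<^sup>2) - 2 * (r * (C * r + C * t) + s * (C * r + t) + t * s)"
    by (simp add: algebra_simps power2_eq_square)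
  finally show ?thesis by simp
qed

text \<open>Away from the singular point the system is linear with continuous coefficients, so that the
  squared norm of a solution satisfies a Gronwall inequality in both directions.\<close>

lemma eigen_system_unique_zero:
  assumes sol: "solves_eigen_system L a b l W S" and S: "is_interval S" and y: "y \<in> S" and z: "z \<in> S"
    and a0: "\<And>x. x \<in> S \<Longrightarrow> a x \<noteq> 0"
    and cont: "continuous_on S a" "continuous_on S (deriv a)" "continuous_on S b"
    and W0: "W y = 0"
  shows "W z = 0"
proof -
  let ?J = "closed_segment y z"
  have J: "?J \<subseteq> S" using S y z
    by (metis closed_segment_subset is_interval_convex_1)
  let ?k = "\<lambda>x. - (l + of_real (deriv a x) + of_real (L * b x)) / of_real (a x)"
  let ?m = "\<lambda>x. of_real L / of_real (a x) :: complex"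
  have contJ: "continuous_on ?J a" "continuous_on ?J (deriv a)" "continuous_on ?J b"
    using cont J by (auto intro: continuous_on_subset)
  have "continuous_on ?J (\<lambda>x. norm (?k x) + norm (?m x) + \<bar>b x\<bar>)"
    using a0 J by (intro continuous_intros contJ) auto
  then have "compact ((\<lambda>x. norm (?k x) + norm (?m x) + \<bar>b x\<bar>) ` ?J)"
    by (rule compact_continuous_image[OF _ compact_segment])
  then obtain C where C: "\<And>x. x \<in> ?J \<Longrightarrow> norm (?k x) + norm (?m x) + \<bar>b x\<bar> \<le> C"
    using bounded_imp_bdd_above[OF compact_imp_bounded] unfolding bdd_above_def by (metis (no_types, lifting) image_eqI)
  let ?u' = "\<lambda>x. ?k x * W x $ 1 + ?m x * W x $ 3"
  let ?q' = "\<lambda>x. of_real (b x) * W x $ 1 - W x $ 3"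
  let ?N = "\<lambda>x. W x $ 1 \<bullet> W x $ 1 + W x $ 2 \<bullet> W x $ 2 + W x $ 3 \<bullet> W x $ 3"
  let ?N' = "\<lambda>x. 2 * (W x $ 1 \<bullet> ?u' x + W x $ 2 \<bullet> ?q' x + W x $ 3 \<bullet> (- W x $ 2))"
  have inn: "((\<lambda>s. F s \<bullet> F s) has_real_derivative 2 * (F x \<bullet> F')) (at x)"
    if "(F has_vector_derivative F') (at x)" for F :: "real \<Rightarrow> complex" and F' x
    using bounded_bilinear.has_vector_derivative[OF bounded_bilinear_inner that that]
    by (simp add: has_real_derivative_iff_has_vector_derivative inner_commute)
  have der: "(?N has_real_derivative ?N' x) (at x)" if x: "x \<in> ?J" for x
  proof -
    have xS: "x \<in> S" using x J by auto
    obtain u' where u: "((\<lambda>s. W s $ 1) has_vector_derivative u') (at x)"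
      and au: "of_real (a x) * u' = - (l + of_real (deriv a x) + of_real (L * b x)) * W x $ 1 + of_real L * W x $ 3"
      and q: "((\<lambda>s. W s $ 2) has_vector_derivative ?q' x) (at x)"
      and p: "((\<lambda>s. W s $ 3) has_vector_derivative (- W x $ 2)) (at x)"
      using sol xS unfolding solves_eigen_system_def by blast
    have "u' = (of_real (a x) * u') / of_real (a x)" using a0[OF xS] by simp
    also have "\<dots> = ?u' x" unfolding au by (simp only: add_divide_distrib times_divide_eq_left)
    finally have u'': "((\<lambda>s. W s $ 1) has_vector_derivative ?u' x) (at x)" using u by simp
    show ?thesis
      by (rule DERIV_cong[OF DERIV_add[OF DERIV_add[OF inn[OF u''] inn[OF q]] inn[OF p]]])
         (simp only: distrib_left)
  qed
  have bound: "\<bar>?N' x\<bar> \<le> (4 * (C + 1) + 2) * ?N x" if x: "x \<in> ?J" for x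
  proof -
    define n1 n2 n3 where "n1 = norm (W x $ 1)" and "n2 = norm (W x $ 2)" and "n3 = norm (W x $ 3)"
    have nn: "n1 \<ge> 0" "n2 \<ge> 0" "n3 \<ge> 0" by (auto simp: n1_def n2_def n3_def)
    have k: "norm (?k x) \<le> C" "norm (?m x) \<le> C" "\<bar>b x\<bar> \<le> C" "0 \<le> C" 
      using C[OF x] norm_ge_zero[of "?k x"] norm_ge_zero[of "?m x"] abs_ge_zero[of "b x"] by linarith+
    have "norm (?u' x) \<le> norm (?k x) * n1 + norm (?m x) * n3"
      unfolding n1_def n3_def by (rule norm_triangle_le) (simp only: norm_mult order_refl)
    also have "\<dots> \<le> C * n1 + C * n3" using k nn by (intro add_mono mult_right_mono)
    finally have u': "norm (?u' x) \<le> C * n1 + C * n3" .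
    have "norm (?q' x) \<le> \<bar>b x\<bar> * n1 + n3"
      unfolding n1_def n3_def by (rule norm_triangle_le_diff) (simp add: norm_mult)
    also have "\<dots> \<le> C * n1 + n3" using k nn by (intro add_mono mult_right_mono) auto
    finally have q': "norm (?q' x) \<le> C * n1 + n3" .
    have tri: "\<bar>2 * (r + s + t)\<bar> \<le> 2 * (A + B + D)"
      if "\<bar>r\<bar> \<le> A" "\<bar>s\<bar> \<le> B" "\<bar>t\<bar> \<le> D" for r s t A B D :: real
      using that unfolding abs_le_iff by (auto simp: algebra_simps)
    have i1: "\<bar>W x $ 1 \<bullet> ?u' x\<bar> \<le> n1 * (C * n1 + C * n3)"
      using order_trans[OF Cauchy_Schwarz_ineq2[of "W x $ 1" "?u' x", folded n1_def] mult_left_mono[OF u' nn(1)]] .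
    have i2: "\<bar>W x $ 2 \<bullet> ?q' x\<bar> \<le> n2 * (C * n1 + n3)"
      using order_trans[OF Cauchy_Schwarz_ineq2[of "W x $ 2" "?q' x", folded n2_def] mult_left_mono[OF q' nn(2)]] .
    have i3: "\<bar>W x $ 3 \<bullet> (- W x $ 2)\<bar> \<le> n3 * n2"
      using Cauchy_Schwarz_ineq2[of "W x $ 3" "- W x $ 2"] n2_def n3_def by simp
    have N: "?N x = n1\<^sup>2 + n2\<^sup>2 + n3\<^sup>2" by (simp add: n1_def n2_def n3_def power2_norm_eq_inner)
    have "\<bar>?N' x\<bar> \<le> 2 * (n1 * (C * n1 + C * n3) + n2 * (C * n1 + n3) + n3 * n2)"
      by (rule tri[OF i1 i2 i3])
    also have "\<dots> \<le> (4 * (C + 1) + 2) * (n1\<^sup>2 + n2\<^sup>2 + n3\<^sup>2)"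
      by (rule quadratic_growth_bound[OF k(4)])
    finally show ?thesis unfolding N .
  qed
  have "?N z = 0"
    by (rule gronwall_zero[of y z ?N ?N' "4 * (C + 1) + 2", OF der bound]) (simp_all add: W0)
  moreover have "W z $ 1 \<bullet> W z $ 1 \<ge> 0" "W z $ 2 \<bullet> W z $ 2 \<ge> 0" "W z $ 3 \<bullet> W z $ 3 \<ge> 0" by simp_all
  ultimately have "W z $ 1 \<bullet> W z $ 1 = 0" "W z $ 2 \<bullet> W z $ 2 = 0" "W z $ 3 \<bullet> W z $ 3 = 0" by linarith+
  then show ?thesis by (simp add: vec_eq_iff forall_3)
qed

section \<open>Monotonicity and slope of the shock profile\<close>

text \<open>A barrier: a function that crosses the level \<open>k\<close> only upwards does not return to it.\<close>

lemma stays_above: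
  fixes z :: "real \<Rightarrow> real"
  assumes st: "s < t" and zs: "z s \<ge> k" and cont: "continuous_on {s..t} z"
    and up: "\<And>x. x \<in> {s..t} \<Longrightarrow> z x = k \<Longrightarrow> \<exists>d>0. (z has_real_derivative d) (at x)"
  shows "z t > k"
proof -
  have aux: False if t': "s \<le> t'" "t' \<le> t" and zt: "z t' < k" for t'
  proof -
    let ?A = "{s..t'} \<inter> {x\<in>{s..t'}. k \<le> z x}"
    have c: "continuous_on {s..t'} z" using cont t' by (auto intro: continuous_on_subset)
    have "closed {x\<in>{s..t'}. k \<le> z x}"
      by (intro continuous_on_closed_Collect_le c continuous_intros closed_atLeastAtMost)
    then have "compact ?A" by (intro compact_Int_closed compact_Icc)
    moreover have "s \<in> ?A" using zs t' by simp
    ultimately obtain y where y: "y \<in> ?A" and ymax: "\<And>x. x \<in> ?A \<Longrightarrow> x \<le> y"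
      using compact_attains_sup[of ?A] by blast
    have yt: "y < t'" using y zt by (cases "y = t'") auto
    have zy: "z y = k"
    proof (rule ccontr)
      assume "z y \<noteq> k"
      then have "z y > k" using y by auto
      moreover have "continuous_on {y..t'} z" using c y by (auto intro: continuous_on_subset)
      ultimately obtain x where "y \<le> x" "x \<le> t'" "z x = k"
        using IVT2'[of z t' k y] zt yt by force
      then show False using ymax[of x] y \<open>z y > k\<close> by force
    qed
    then obtain d where "d > 0" "(z has_real_derivative d) (at y)"
      using up[of y] y t' by auto
    then obtain e where e: "e > 0" "\<And>h. 0 < h \<Longrightarrow> h < e \<Longrightarrow> z y < z (y + h)"
      using DERIV_pos_inc_right by blast
    define h where "h = min (e / 2) (t' - y)"
    have "0 < h" "h < e" "y + h \<le> t'" using e(1) yt by (auto simp: h_def)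
    then have "y + h \<in> ?A" using e(2)[of h] zy y by auto
    then show False using ymax[of "y + h"] \<open>0 < h\<close> by simp
  qed
  show ?thesis
  proof (rule ccontr)
    assume "\<not> z t > k"
    moreover have "\<not> z t < k" using aux[of t] st by auto
    ultimately have zt: "z t = k" by simp
    then obtain d where "d > 0" "(z has_real_derivative d) (at t)" using up[of t] st by auto
    then obtain e where e: "e > 0" "\<And>h. 0 < h \<Longrightarrow> h < e \<Longrightarrow> z (t - h) < z t"
      using DERIV_pos_inc_left by blast
    define h where "h = min (e / 2) (t - s)"
    have "0 < h" "h < e" "s \<le> t - h" using e(1) st by (auto simp: h_def)
    then show False using aux[of "t - h"] e(2)[of h] zt by simp
  qed
qed

text \<open>The second-order condition is stated for every possible second derivative, since \<open>U\<close> is only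
  assumed to be once differentiable in general.\<close>

lemma interior_dip:
  fixes U :: "real \<Rightarrow> real"
  assumes ord: "r < s" "s < t" and low: "U s < U r" "U s < U t"
    and U: "\<And>x. (U has_real_derivative U' x) (at x)"
  obtains x where "r < x" "x < t" "U x \<le> U s" "U' x = 0"
    "\<And>l. (U' has_real_derivative l) (at x) \<Longrightarrow> l \<ge> 0"
proof -
  have cont: "continuous_on {r..t} U" by (rule DERIV_continuous_on[OF has_field_derivative_at_within[OF U]])
  obtain x where x: "x \<in> {r..t}" and xmin: "\<And>y. y \<in> {r..t} \<Longrightarrow> U x \<le> U y"
    using continuous_attains_inf[OF compact_Icc _ cont] ord by (metis atLeastAtMost_iff empty_iff less_imp_le)
  have xs: "U x \<le> U s" using xmin[of s] ord by simp
  then have xin: "r < x" "x < t" using x low by (auto simp: less_le)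
  define e where "e = min (x - r) (t - x)"
  have e: "e > 0" "\<And>y. \<bar>x - y\<bar> < e \<Longrightarrow> U x \<le> U y"
    using xin xmin by (auto simp: e_def abs_less_iff)
  have U0: "U' x = 0" by (rule DERIV_local_min[OF U e(1)]) (use e(2) in auto)
  have "l \<ge> 0" if l: "(U' has_real_derivative l) (at x)" for l
  proof (rule ccontr)
    assume "\<not> l \<ge> 0"
    then obtain d where d: "d > 0" "\<And>h. 0 < h \<Longrightarrow> h < d \<Longrightarrow> U' x > U' (x + h)"
      using DERIV_neg_dec_right[OF l] by auto
    define h where "h = min (d / 2) (e / 2)"
    have h: "0 < h" "h < d" "h < e" using d e by (auto simp: h_def)
    obtain \<xi> where \<xi>: "x < \<xi>" "\<xi> < x + h" "U (x + h) - U x = (x + h - x) * U' \<xi>"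
      using MVT2[of x "x + h" U U'] U h by auto
    have "U' \<xi> < 0" using d(2)[of "\<xi> - x"] \<xi> h U0 by simp
    then have "U (x + h) < U x" using \<xi>(3) mult_pos_neg[OF h(1)] by fastforce
    then show False using e(2)[of "x + h"] h by simp
  qed
  then show ?thesis using that xin xs U0 by blast
qed

lemma interior_bump:
  fixes U :: "real \<Rightarrow> real"
  assumes ord: "r < s" "s < t" and high: "U s > U r" "U s > U t"
    and U: "\<And>x. (U has_real_derivative U' x) (at x)"
  obtains x where "r < x" "x < t" "U x \<ge> U s" "U' x = 0"
    "\<And>l. (U' has_real_derivative l) (at x) \<Longrightarrow> l \<le> 0"
proof -
  have "((\<lambda>x. - U x) has_real_derivative - U' x) (at x)" for x by (intro DERIV_minus U)
  then obtain x where x: "r < x" "x < t" "- U x \<le> - U s" "- U' x = 0"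
    "\<And>l. ((\<lambda>x. - U' x) has_real_derivative l) (at x) \<Longrightarrow> l \<ge> 0"
    using interior_dip[of r s t "\<lambda>x. - U x" "\<lambda>x. - U' x"] ord high by auto
  have "l \<le> 0" if "(U' has_real_derivative l) (at x)" for l
    using x(5)[OF DERIV_minus[OF that]] by simp
  then show ?thesis using that x by simp
qed

lemma eventually_at_bot_less:
  fixes s :: real
  assumes "eventually P at_bot"
  shows "\<exists>r<s. P r"
proof -
  obtain N where "\<And>n. n \<le> N \<Longrightarrow> P n" using assms by (auto simp: eventually_at_bot_linorder)
  then show ?thesis by (intro exI[of _ "min N (s - 1)"]) auto
qed

lemma eventually_at_top_greater:
  fixes s :: real
  assumes "eventually P at_top"
  shows "\<exists>r>s. P r"
proof -
  obtain N where "\<And>n. n \<ge> N \<Longrightarrow> P n" using assms by (auto simp: eventually_at_top_linorder)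
  then show ?thesis by (intro exI[of _ "max N (s + 1)"]) auto
qed

text \<open>The product rule at a zero of one factor needs only continuity of the other. It gives
  \<open>(a U')' = a' U'\<close> at the sonic point, where \<open>U''\<close> need not exist.\<close>

lemma DERIV_mult_zero:
  fixes f g :: "real \<Rightarrow> real"
  assumes f: "(f has_real_derivative f') (at x)" and f0: "f x = 0" and g: "isCont g x"
  shows "((\<lambda>s. f s * g s) has_real_derivative f' * g x) (at x)"
proof -
  have "((\<lambda>y. (f y - f x) / (y - x) * g y) \<longlongrightarrow> f' * g x) (at x)"
    using f g by (intro tendsto_mult) (auto simp: has_field_derivative_iff isCont_def)
  then show ?thesis by (simp add: has_field_derivative_iff f0)
qed

lemma Ck_on_5_derivs:
  assumes "Ck_on 5 g I" "u \<in> I"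
  shows "(g has_real_derivative deriv g u) (at u)"
    and "(deriv g has_real_derivative deriv (deriv g) u) (at u)"
    and "isCont (deriv (deriv g)) u"
proof -
  have d: "(deriv ^^ i) g field_differentiable at u" if "i < 5" for i
    using assms that unfolding Ck_on_def by blast
  show "(g has_real_derivative deriv g u) (at u)"
    using d[of 0] by (simp add: DERIV_deriv_iff_field_differentiable)
  show "(deriv g has_real_derivative deriv (deriv g) u) (at u)"
    using d[of 1] by (simp add: DERIV_deriv_iff_field_differentiable)
  have "deriv (deriv g) field_differentiable at u"
    using d[of 2] by (simp add: numeral_2_eq_2)
  then show "isCont (deriv (deriv g)) u" by (rule field_differentiable_imp_continuous_at)
qed

locale shock_profile =
  fixes I :: "real set" and f M :: "real \<Rightarrow> real" and L um up :: real and U Q :: "real \<Rightarrow> real"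
  assumes I_interval: "is_interval I"
    and f_smooth: "Ck_on 5 f I" and M_smooth: "Ck_on 5 M I"
    and convex: "\<And>u. u \<in> I \<Longrightarrow> deriv (deriv f) u > 0"
    and LM_pos: "\<And>u. u \<in> I \<Longrightarrow> L * deriv M u > 0"
    and um_in: "um \<in> I" and up_in: "up \<in> I" and f_ends: "f um = f up" and up_less_um: "up < um"
    and profile: "radiative_profile I f M L um up U Q"
begin

definition a :: "real \<Rightarrow> real" where "a x = deriv f (U x)"
definition b :: "real \<Rightarrow> real" where "b x = deriv M (U x)"

text \<open>\<open>R\<close> equals \<open>L Q\<close> (lemma \<open>R_eq\<close>); in terms of it the profile equation has no explicit \<open>Q\<close>.\<close>

definition R :: "real \<Rightarrow> real" where "R x = f um - f (U x)"

lemma U_in: "U x \<in> I"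
  using profile unfolding radiative_profile_def by auto

lemmas f_derivs = Ck_on_5_derivs[OF f_smooth] and M_derivs = Ck_on_5_derivs[OF M_smooth]

lemma U_deriv: "(U has_real_derivative deriv U x) (at x)"
  and deriv_U_cont: "isCont (deriv U) x"
proof -
  have C: "Ck_on 1 U UNIV" using profile unfolding radiative_profile_def by blast
  have "(deriv ^^ 0) U field_differentiable at x" using C unfolding Ck_on_def by blast
  then show "(U has_real_derivative deriv U x) (at x)"
    by (simp add: DERIV_deriv_iff_field_differentiable)
  have "continuous_on UNIV ((deriv ^^ 1) U)" using C unfolding Ck_on_def by blast
  then show "isCont (deriv U) x" by (simp add: continuous_on_eq_continuous_at)
qed

lemma a_deriv: "(a has_real_derivative deriv (deriv f) (U x) * deriv U x) (at x)"
  unfolding a_def[abs_def] by (rule DERIV_chain2[OF f_derivs(2)[OF U_in] U_deriv])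

lemma b_deriv: "(b has_real_derivative deriv (deriv M) (U x) * deriv U x) (at x)"
  unfolding b_def[abs_def] by (rule DERIV_chain2[OF M_derivs(2)[OF U_in] U_deriv])

lemma flux_deriv: "((\<lambda>s. f (U s)) has_real_derivative a x * deriv U x) (at x)"
  unfolding a_def by (rule DERIV_chain2[OF f_derivs(1)[OF U_in] U_deriv])

lemma Q_deriv: "(Q has_real_derivative deriv Q x) (at x)"
  and Q_deriv2: "(deriv Q has_real_derivative deriv (deriv Q) x) (at x)"
proof -
  have C: "Ck_on 2 Q UNIV" using profile unfolding radiative_profile_def by blast
  have d: "(deriv ^^ i) Q field_differentiable at x" if "i < 2" for i
    using C that unfolding Ck_on_def by blast
  show "(Q has_real_derivative deriv Q x) (at x)" "(deriv Q has_real_derivative deriv (deriv Q) x) (at x)"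
    using d[of 0] d[of 1] by (simp_all add: DERIV_deriv_iff_field_differentiable)
qed

lemma aU_eq: "a x * deriv U x = - (L * deriv Q x)"
proof -
  have "deriv (\<lambda>s. f (U s)) x + L * deriv Q x = 0"
    using profile unfolding radiative_profile_def by blast
  then show ?thesis using DERIV_imp_deriv[OF flux_deriv, of x] by simp
qed

lemma R_eq: "R x = L * Q x"
proof -
  have "((\<lambda>s. f (U s) + L * Q s) has_real_derivative a x * deriv U x + L * deriv Q x) (at x)" for x
    by (intro DERIV_add flux_deriv DERIV_cmult Q_deriv)
  then have "((\<lambda>s. f (U s) + L * Q s) has_real_derivative 0) (at x)" for x
    by (simp add: aU_eq)
  then have const: "f (U x) + L * Q x = f (U y) + L * Q y" for y
    by (intro DERIV_isconst_all) blast
  have "isCont f um" using f_derivs(1)[OF um_in] by (rule DERIV_isCont)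
  moreover have "(U \<longlongrightarrow> um) at_bot" "(Q \<longlongrightarrow> 0) at_bot"
    using profile unfolding radiative_profile_def by blast+
  ultimately have "((\<lambda>y. f (U y) + L * Q y) \<longlongrightarrow> f um + L * 0) at_bot"
    by (intro tendsto_add tendsto_mult tendsto_const isCont_tendsto_compose[where g = f])
  moreover have "((\<lambda>y. f (U y) + L * Q y) \<longlongrightarrow> f (U x) + L * Q x) at_bot"
    by (rule tendsto_eventually) (rule always_eventually, rule allI, rule const[symmetric])
  ultimately have "f um + L * 0 = f (U x) + L * Q x"
    using tendsto_unique[OF trivial_limit_at_bot_linorder] by blast
  then show ?thesis by (simp add: R_def)
qed

lemma aU_deriv: "((\<lambda>s. a s * deriv U s) has_real_derivative - (R x + L * b x * deriv U x)) (at x)"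
proof -
  have "- deriv (deriv Q) x + Q x + deriv (\<lambda>s. M (U s)) x = 0"
    using profile unfolding radiative_profile_def by blast
  moreover have "((\<lambda>s. M (U s)) has_real_derivative b x * deriv U x) (at x)"
    unfolding b_def by (rule DERIV_chain2[OF M_derivs(1)[OF U_in] U_deriv])
  ultimately have "deriv (deriv Q) x = Q x + b x * deriv U x" by (simp add: DERIV_imp_deriv)
  moreover have "((\<lambda>s. - (L * deriv Q s)) has_real_derivative - (L * deriv (deriv Q) x)) (at x)"
    by (intro DERIV_minus DERIV_cmult Q_deriv2)
  moreover have "(\<lambda>s. - (L * deriv Q s)) = (\<lambda>s. a s * deriv U s)" by (simp only: aU_eq)
  moreover have "R x + L * b x * deriv U x = L * (Q x + b x * deriv U x)"
    unfolding R_eq by (simp only: distrib_left mult.assoc)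
  ultimately show ?thesis by simp
qed

lemma Lb_pos: "L * b x > 0"
  unfolding b_def by (rule LM_pos[OF U_in])

lemma segment_in: "u \<in> I \<Longrightarrow> v \<in> I \<Longrightarrow> u \<le> w \<Longrightarrow> w \<le> v \<Longrightarrow> w \<in> I"
  using I_interval unfolding is_interval_1 by blast

lemma deriv_f_less: "deriv f u < deriv f v" if uv: "u \<in> I" "v \<in> I" "u < v"
proof (rule DERIV_pos_imp_increasing[OF uv(3)])
  fix w assume "u \<le> w" "w \<le> v"
  then have "w \<in> I" using segment_in[of u v w] uv by blast
  then show "\<exists>y. (deriv f has_real_derivative y) (at w) \<and> 0 < y"
    using f_derivs(2)[of w] convex[of w] by blast
qed

lemma sonic: "deriv f (U 0) = 0"
  using profile unfolding radiative_profile_def by blast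

lemma f_increasing: "f u < f v" if "v \<in> I" "U 0 \<le> u" "u < v"
proof (rule DERIV_pos_imp_increasing_open[OF \<open>u < v\<close>])
  have I: "w \<in> I" if "u \<le> w" "w \<le> v" for w using segment_in[OF U_in[of 0] \<open>v \<in> I\<close>] that \<open>U 0 \<le> u\<close> by simp
  show "\<exists>y. (f has_real_derivative y) (at w) \<and> 0 < y" if "u < w" "w < v" for w
    using f_derivs(1)[of w] I[of w] deriv_f_less[of "U 0" w] U_in[of 0] sonic that \<open>U 0 \<le> u\<close> by auto
  show "continuous_on {u..v} f"
    using f_derivs(1) I by (intro DERIV_continuous_on[where D = "deriv f"]) (auto intro: has_field_derivative_at_within)
qed

lemma f_decreasing: "f v < f u" if "u \<in> I" "v \<le> U 0" "u < v"
proof (rule DERIV_neg_imp_decreasing_open[OF \<open>u < v\<close>])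
  have I: "w \<in> I" if "u \<le> w" "w \<le> v" for w using segment_in[OF \<open>u \<in> I\<close> U_in[of 0]] that \<open>v \<le> U 0\<close> by simp
  show "\<exists>y. (f has_real_derivative y) (at w) \<and> y < 0" if "u < w" "w < v" for w
    using f_derivs(1)[of w] I[of w] deriv_f_less[of w "U 0"] U_in[of 0] sonic that \<open>v \<le> U 0\<close> by auto
  show "continuous_on {u..v} f"
    using f_derivs(1) I by (intro DERIV_continuous_on[where D = "deriv f"]) (auto intro: has_field_derivative_at_within)
qed

lemma sonic_between: "up < U 0" "U 0 < um"
proof -
  show "up < U 0"
    using f_increasing[OF um_in _ up_less_um] f_ends by (cases "up < U 0") auto
  show "U 0 < um"
    using f_decreasing[OF up_in _ up_less_um] f_ends by (cases "U 0 < um") auto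
qed

lemma R_pos: "R x > 0" if "up < U x" "U x < um"
proof (cases "U x \<ge> U 0")
  case True then show ?thesis using f_increasing[of um "U x"] um_in that by (simp add: R_def)
next
  case False then show ?thesis using f_decreasing[of up "U x"] up_in that f_ends by (simp add: R_def)
qed

lemma R_neg: "R x < 0" if "U x < up \<or> um < U x"
  using that
proof
  assume "um < U x" then show ?thesis
    using f_increasing[of "U x" um] U_in sonic_between by (simp add: R_def)
next
  assume "U x < up" then show ?thesis
    using f_decreasing[of "U x" up] U_in sonic_between f_ends by (simp add: R_def)
qed

lemma R_le: "R x \<le> f um - f (U 0)"
proof -
  consider "U x < U 0" | "U x = U 0" | "U x > U 0" by linarith
  then have "f (U 0) \<le> f (U x)"
    using f_increasing[of "U x" "U 0"] f_decreasing[of "U x" "U 0"] U_in[of x] by cases auto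
  then show ?thesis by (simp add: R_def)
qed

lemma a_sign: "a x = 0 \<longleftrightarrow> U x = U 0" "a x > 0 \<longleftrightarrow> U x > U 0"
proof -
  consider "U x < U 0" | "U x = U 0" | "U x > U 0" by linarith
  then have "(a x = 0 \<longleftrightarrow> U x = U 0) \<and> (a x > 0 \<longleftrightarrow> U x > U 0)"
  proof cases
    case 1 then show ?thesis using deriv_f_less[OF U_in U_in 1] sonic by (simp add: a_def)
  next
    case 2 then show ?thesis using sonic by (simp add: a_def)
  next
    case 3 then show ?thesis using deriv_f_less[OF U_in U_in 3] sonic by (simp add: a_def)
  qed
  then show "a x = 0 \<longleftrightarrow> U x = U 0" "a x > 0 \<longleftrightarrow> U x > U 0" by blast+
qed

text \<open>At the sonic point \<open>(a U')'\<close> equals both \<open>a' U' = f''(U) U'\<^sup>2\<close> and, by the profile equation,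
  \<open>- R - L b U'\<close>.\<close>

lemma sonic_slope:
  assumes "a x = 0"
  shows "deriv (deriv f) (U x) * (deriv U x)\<^sup>2 + L * b x * deriv U x + R x = 0"
proof -
  have "((\<lambda>s. a s * deriv U s) has_real_derivative deriv (deriv f) (U x) * deriv U x * deriv U x) (at x)"
    by (rule DERIV_mult_zero[OF a_deriv assms deriv_U_cont])
  from DERIV_unique[OF this aU_deriv] show ?thesis
    by (simp add: power2_eq_square mult.assoc)
qed

lemma sonic_slope_neg: assumes "a x = 0" shows "deriv U x < 0"
proof -
  have "U x = U 0" using assms a_sign(1) by simp
  then have "R x > 0" using R_pos sonic_between by simp
  moreover have "deriv (deriv f) (U x) * (deriv U x)\<^sup>2 \<ge> 0" using convex[OF U_in[of x]] by simp
  ultimately have "L * b x * deriv U x < 0" using sonic_slope[OF assms] by linarith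
  then show ?thesis using Lb_pos[of x] by (meson less_asym mult_less_0_iff)
qed

lemma a_cont: "continuous_on S a"
  by (rule DERIV_continuous_on[OF has_field_derivative_at_within[OF a_deriv]])

text \<open>At every zero of \<open>a\<close> the derivative \<open>a' = f''(U) U'\<close> is negative, so \<open>a\<close> has no zero besides
  \<open>x = 0\<close>.\<close>

lemma a_neg: "a x < 0" if "x > 0"
proof -
  have "- a x > 0"
  proof (rule stays_above[OF that])
    show "0 \<le> - a 0" by (simp add: a_def sonic)
    show "continuous_on {0..x} (\<lambda>x. - a x)" by (intro continuous_intros a_cont)
    fix y assume "- a y = 0"
    then have "deriv U y < 0" using sonic_slope_neg[of y] by simp
    then have "- (deriv (deriv f) (U y) * deriv U y) > 0" using convex[OF U_in[of y]] by (simp add: mult_pos_neg)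
    then show "\<exists>d>0. ((\<lambda>x. - a x) has_real_derivative d) (at y)"
      using DERIV_minus[OF a_deriv[of y]] by blast
  qed
  then show ?thesis by simp
qed

lemma a_pos: "a x > 0" if "x < 0"
proof -
  have "a (- (- x)) > 0"
  proof (rule stays_above[where z = "\<lambda>s. a (- s)" and s = 0])
    show "0 < - x" using that by simp
    show "0 \<le> a (- 0)" by (simp add: a_def sonic)
    show "continuous_on {0..- x} (\<lambda>s. a (- s))"
      by (rule continuous_on_compose2[OF a_cont[of UNIV]]) (auto intro: continuous_intros)
    fix y assume "a (- y) = 0"
    then have "deriv U (- y) < 0" by (rule sonic_slope_neg)
    then have "- (deriv (deriv f) (U (- y)) * deriv U (- y)) > 0" using convex[OF U_in[of "- y"]] by (simp add: mult_pos_neg)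
    moreover have "((\<lambda>s. a (- s)) has_real_derivative - (deriv (deriv f) (U (- y)) * deriv U (- y))) (at y)"
      by (rule DERIV_cong[OF DERIV_chain2[OF a_deriv]]) (auto intro!: derivative_eq_intros)
    ultimately show "\<exists>d>0. ((\<lambda>s. a (- s)) has_real_derivative d) (at y)" by blast
  qed
  then show ?thesis by simp
qed

lemma a_nonzero: "x \<noteq> 0 \<Longrightarrow> a x \<noteq> 0"
  using a_pos[of x] a_neg[of x] by (cases x "0::real" rule: linorder_cases) auto

lemma U_less_sonic: "x > 0 \<Longrightarrow> U x < U 0"
  using a_neg[of x] a_sign[of x] by linarith

lemma U_greater_sonic: "x < 0 \<Longrightarrow> U x > U 0"
  using a_pos[of x] a_sign(2)[of x] by simp

lemma deriv_U_deriv: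
  assumes "x \<noteq> 0"
  shows "(deriv U has_real_derivative
    - (deriv (deriv f) (U x) * (deriv U x)\<^sup>2 + L * b x * deriv U x + R x) / a x) (at x)"
proof -
  have "((\<lambda>s. a s * deriv U s / a s) has_real_derivative
     (- (R x + L * b x * deriv U x) * a x - a x * deriv U x * (deriv (deriv f) (U x) * deriv U x)) / (a x * a x)) (at x)"
    by (rule DERIV_divide[OF aU_deriv a_deriv a_nonzero[OF assms]])
  then have "((\<lambda>s. a s * deriv U s / a s) has_real_derivative
     - (deriv (deriv f) (U x) * (deriv U x)\<^sup>2 + L * b x * deriv U x + R x) / a x) (at x)"
    by (rule DERIV_cong) (use a_nonzero[OF assms] in \<open>simp add: field_simps power2_eq_square\<close>)
  then show ?thesis
    by (rule has_field_derivative_transform_within_open[where S = "- {0}"])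
       (use assms a_nonzero in \<open>auto simp: open_Compl\<close>)
qed

lemma U_at_bot: "(U \<longlongrightarrow> um) at_bot" and U_at_top: "(U \<longlongrightarrow> up) at_top"
  using profile unfolding radiative_profile_def by blast+

text \<open>At a critical point \<open>U'' = - R / a\<close>. Where \<open>U > um\<close> this is positive, because \<open>R < 0 < a\<close>,
  so an overshoot could have no maximum. The other three comparison lemmas use the same sign pattern,
  with \<open>R > 0\<close> strictly between the end states.\<close>

lemma U_le: "U x \<le> um"
proof (rule ccontr)
  assume "\<not> U x \<le> um"
  then have gt: "um < U x" by simp
  obtain r where r: "r < x" "U r < U x"
    using eventually_at_bot_less[OF order_tendstoD(2)[OF U_at_bot gt]] by blast
  obtain t where t: "x < t" "U t < U x"
    using eventually_at_top_greater[OF order_tendstoD(2)[OF U_at_top order.strict_trans[OF up_less_um gt]]] by blast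
  obtain y where y: "U y \<ge> U x" "deriv U y = 0" and d: "\<And>l. (deriv U has_real_derivative l) (at y) \<Longrightarrow> l \<le> 0"
    using interior_bump[OF r(1) t(1) r(2) t(2)] U_deriv by metis
  have "y < 0" using U_less_sonic[of y] sonic_between y(1) gt by (cases y "0::real" rule: linorder_cases) auto
  then have "- R y / a y \<le> 0" using d[OF deriv_U_deriv[of y]] y(2) by simp
  moreover have "R y < 0" using R_neg[of y] y(1) gt by simp
  ultimately show False using divide_neg_pos[OF _ a_pos[OF \<open>y < 0\<close>]] by fastforce
qed

lemma U_ge: "up \<le> U x"
proof (rule ccontr)
  assume "\<not> up \<le> U x"
  then have lt: "U x < up" by simp
  obtain r where r: "r < x" "U x < U r"
    using eventually_at_bot_less[OF order_tendstoD(1)[OF U_at_bot order.strict_trans[OF lt up_less_um]]] by blast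
  obtain t where t: "x < t" "U x < U t"
    using eventually_at_top_greater[OF order_tendstoD(1)[OF U_at_top lt]] by blast
  obtain y where y: "U y \<le> U x" "deriv U y = 0" and d: "\<And>l. (deriv U has_real_derivative l) (at y) \<Longrightarrow> l \<ge> 0"
    using interior_dip[OF r(1) t(1) r(2) t(2)] U_deriv by metis
  have "y > 0" using U_greater_sonic[of y] sonic_between y(1) lt by (cases y "0::real" rule: linorder_cases) auto
  then have "- R y / a y \<ge> 0" using d[OF deriv_U_deriv[of y]] y(2) by simp
  moreover have "R y < 0" using R_neg[of y] y(1) lt by simp
  ultimately show False using divide_neg_neg[OF _ a_neg[OF \<open>y > 0\<close>]] by fastforce
qed

lemma U_antimono_left: "U t \<le> U s" if st0: "s < t" "t < 0"
proof (rule ccontr)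
  assume "\<not> U t \<le> U s"
  then have st: "U s < U t" by simp
  then have "U s < um" using U_le[of t] by simp
  then obtain r where r: "r < s" "U s < U r"
    using eventually_at_bot_less[OF order_tendstoD(1)[OF U_at_bot]] by blast
  obtain y where y: "y < t" "U y \<le> U s" "deriv U y = 0" and d: "\<And>l. (deriv U has_real_derivative l) (at y) \<Longrightarrow> l \<ge> 0"
    using interior_dip[OF r(1) st0(1) r(2) st] U_deriv by metis
  have "y < 0" using y(1) st0 by simp
  then have "- R y / a y \<ge> 0" using d[OF deriv_U_deriv[of y]] y(3) by simp
  moreover have "R y > 0"
    using R_pos[of y] y(2) \<open>U s < um\<close> U_greater_sonic[OF \<open>y < 0\<close>] sonic_between by simp
  ultimately show False using divide_pos_pos[OF _ a_pos[OF \<open>y < 0\<close>]] by fastforce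
qed

lemma U_antimono_right: "U t \<le> U s" if st0: "s < t" "0 < s"
proof (rule ccontr)
  assume "\<not> U t \<le> U s"
  then have st: "U s < U t" by simp
  then have "up < U t" using U_ge[of s] by simp
  then obtain r where r: "t < r" "U r < U t"
    using eventually_at_top_greater[OF order_tendstoD(2)[OF U_at_top]] by blast
  obtain y where y: "s < y" "U y \<ge> U t" "deriv U y = 0" and d: "\<And>l. (deriv U has_real_derivative l) (at y) \<Longrightarrow> l \<le> 0"
    using interior_bump[OF st0(1) r(1) st r(2)] U_deriv by metis
  have "y > 0" using y(1) st0 by simp
  then have "- R y / a y \<le> 0" using d[OF deriv_U_deriv[of y]] y(3) by simp
  moreover have "R y > 0"
    using R_pos[of y] y(2) \<open>up < U t\<close> U_less_sonic[OF \<open>y > 0\<close>] sonic_between by simp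
  ultimately show False using divide_pos_neg[OF _ a_neg[OF \<open>y > 0\<close>]] by fastforce
qed

lemma deriv_U_nonpos: "deriv U x \<le> 0"
proof (rule ccontr)
  assume "\<not> deriv U x \<le> 0"
  then have pos: "deriv U x > 0" by simp
  then obtain d where d: "d > 0" "\<And>h. 0 < h \<Longrightarrow> h < d \<Longrightarrow> U x < U (x + h)"
    using DERIV_pos_inc_right[OF U_deriv] by blast
  obtain e where e: "e > 0" "\<And>h. 0 < h \<Longrightarrow> h < e \<Longrightarrow> U (x - h) < U x"
    using DERIV_pos_inc_left[OF U_deriv pos] by blast
  show False
  proof (cases "x > 0")
    case True then show False using d(2)[of "d/2"] d(1) U_antimono_right[of x "x + d/2"] by simp
  next
    case False
    then have "x < 0" using sonic_slope_neg[of 0] pos by (cases "x = 0") (auto simp: a_def sonic)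
    then show False using e(2)[of "e/2"] e(1) U_antimono_left[of "x - e/2" x] by simp
  qed
qed

lemma a_deriv_nonpos: "deriv a x \<le> 0"
  using DERIV_imp_deriv[OF a_deriv] convex[OF U_in[of x]] deriv_U_nonpos[of x]
  by (simp add: mult_nonneg_nonpos)

text \<open>By \<open>gap\<close> the level \<open>k\<close> lies strictly between the two roots of \<open>f''(U) z\<^sup>2 - L b z + R\<close>, which equals
  \<open>a z'\<close> for \<open>z = - U'\<close>. At \<open>x = 0\<close>, where \<open>a\<close> vanishes, \<open>z\<close> is one of the roots, and \<open>weak\<close> places it
  below their mean; it is the smaller root and hence below \<open>k\<close>. Away from \<open>0\<close> the sign of \<open>a\<close>
  lets \<open>z\<close> cross the level \<open>k\<close> only upwards when moving outwards, so a slope that reaches \<open>k\<close>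
  stays above \<open>k\<close> up to infinity, which contradicts the convergence of \<open>U\<close>.\<close>

lemma slope_bound:
  assumes k: "k > 0"
    and gap: "\<And>x. deriv (deriv f) (U x) * k\<^sup>2 - L * b x * k + R x < 0"
    and weak: "L * b 0 + 2 * deriv a 0 > 0"
  shows "- deriv U x < k"
proof -
  let ?z = "\<lambda>x. - deriv U x"
  have level: "- (deriv (deriv f) (U x) * (deriv U x)\<^sup>2 + L * b x * deriv U x + R x) > 0" if "?z x = k" for x
  proof -
    have "deriv U x = - k" using that by simp
    then show ?thesis using gap[of x] by simp
  qed
  have z_cont: "continuous_on S ?z" for S
    using deriv_U_cont by (intro continuous_intros continuous_at_imp_continuous_on) auto
  have z0: "?z 0 < k"
  proof (rule ccontr)
    assume "\<not> ?z 0 < k"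
    then have kz: "k \<le> ?z 0" by simp
    let ?A = "deriv (deriv f) (U 0)" and ?B = "L * b 0"
    have A: "?A > 0" by (rule convex[OF U_in])
    have root: "?A * (?z 0)\<^sup>2 - ?B * ?z 0 + R 0 = 0" using sonic_slope[of 0] by (simp add: a_def sonic)
    have "?A * (?z 0 + k) \<le> ?A * (2 * ?z 0)" using A kz by (intro mult_left_mono) auto
    also have "\<dots> < ?B" using weak DERIV_imp_deriv[OF a_deriv, of 0] by simp
    finally have "(?z 0 - k) * (?A * (?z 0 + k) - ?B) \<le> 0" using kz by (intro mult_nonneg_nonpos) auto
    then have "?A * (?z 0)\<^sup>2 - ?B * ?z 0 - (?A * k\<^sup>2 - ?B * k) \<le> 0" by (simp add: algebra_simps power2_eq_square)
    then show False using root gap[of 0] by simp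
  qed
  have slope: "\<exists>\<xi>. s < \<xi> \<and> \<xi> < s + 1 \<and> U (s + 1) - U s = deriv U \<xi>" for s
    using MVT2[of s "s + 1" U "deriv U"] U_deriv by auto
  show ?thesis
  proof (rule ccontr)
    assume "\<not> ?thesis"
    then have zx: "k \<le> ?z x" by simp
    then have "x \<noteq> 0" using z0 by auto
    then consider "x > 0" | "x < 0" by linarith
    then show False
    proof cases
      case 1
      have far: "?z t > k" if t: "t > x" for t
      proof (rule stays_above[where z = ?z, OF t zx z_cont])
        fix y assume y: "y \<in> {x..t}" "?z y = k"
        then have y0: "y > 0" using 1 by simp
        let ?d = "- (deriv (deriv f) (U y) * (deriv U y)\<^sup>2 + L * b y * deriv U y + R y) / a y"
        have "(?z has_real_derivative - ?d) (at y)" using y0 by (intro DERIV_minus deriv_U_deriv) simp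
        moreover have "- ?d > 0" using level[OF y(2)] a_neg[OF y0] by (simp add: divide_pos_neg)
        ultimately show "\<exists>d>0. (?z has_real_derivative d) (at y)" by blast
      qed
      have ev: "eventually (\<lambda>s. U (s + 1) - U s \<le> - k) at_top"
        unfolding eventually_at_top_linorder
        using slope far by (intro exI[of _ x]) (smt (verit) less_eq_real_def)
      have "((\<lambda>s. U (s + 1) - U s) \<longlongrightarrow> up - up) at_top"
        by (intro tendsto_diff U_at_top filterlim_compose[OF U_at_top]
              filterlim_tendsto_add_at_top[OF tendsto_const filterlim_ident, of 1, unfolded add.commute[of 1]])
      then have "up - up \<le> - k" by (rule tendsto_upperbound[OF _ ev]) simp
      then show False using k by simp
    next
      case 2
      have far: "?z t > k" if t: "t < x" for t
      proof -
        have "?z (- (- t)) > k"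
        proof (rule stays_above[of "- x" "- t" k "\<lambda>s. ?z (- s)"])
          show "- x < - t" "k \<le> ?z (- (- x))" using t zx by auto
          show "continuous_on {- x..- t} (\<lambda>s. ?z (- s))"
            by (rule continuous_on_compose2[OF z_cont[of UNIV]]) (auto intro: continuous_intros)
          fix y assume y: "y \<in> {- x..- t}" "?z (- y) = k"
          then have y0: "- y < 0" using 2 by simp
          let ?d = "- (deriv (deriv f) (U (- y)) * (deriv U (- y))\<^sup>2 + L * b (- y) * deriv U (- y) + R (- y)) / a (- y)"
          have "((\<lambda>s. ?z (- s)) has_real_derivative - (?d * - 1)) (at y)"
            using y0 by (intro DERIV_minus DERIV_chain2[OF deriv_U_deriv] derivative_intros) (auto intro!: derivative_eq_intros)
          moreover have "- (?d * - 1) > 0" using level[OF y(2)] a_pos[OF y0] by simp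
          ultimately show "\<exists>d>0. ((\<lambda>s. ?z (- s)) has_real_derivative d) (at y)" by blast
        qed
        then show ?thesis by simp
      qed
      have "U (s + 1) - U s \<le> - k" if "s \<le> x - 1" for s
        using slope[of s] far that by (smt (verit))
      then have ev: "eventually (\<lambda>s. U (s + 1) - U s \<le> - k) at_bot"
        unfolding eventually_at_bot_linorder by blast
      have "filterlim (\<lambda>s::real. s + 1) at_bot at_bot"
        unfolding filterlim_at_bot
      proof
        fix Z :: real
        show "eventually (\<lambda>s. s + 1 \<le> Z) at_bot"
          using eventually_le_at_bot[of "Z - 1"] by (rule eventually_mono) simp
      qed
      then have "((\<lambda>s. U (s + 1) - U s) \<longlongrightarrow> um - um) at_bot"
        by (intro tendsto_diff U_at_bot filterlim_compose[OF U_at_bot])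
      then have "um - um \<le> - k" by (rule tendsto_upperbound[OF _ ev]) simp
      then show False using k by simp
    qed
  qed
qed

lemma deriv_a_cont: "continuous_on S (deriv a)"
proof -
  have "isCont (\<lambda>x. deriv (deriv f) (U x) * deriv U x) x" for x
    by (intro isCont_mult deriv_U_cont isCont_o2[OF DERIV_isCont[OF U_deriv] f_derivs(3)[OF U_in]])
  moreover have "deriv a = (\<lambda>x. deriv (deriv f) (U x) * deriv U x)"
    using DERIV_imp_deriv[OF a_deriv] by blast
  ultimately show ?thesis by (simp add: continuous_at_imp_continuous_on)
qed

lemma a_ends: "deriv f um > 0" "deriv f up < 0"
  using deriv_f_less[OF U_in um_in sonic_between(2)] deriv_f_less[OF up_in U_in sonic_between(1)] sonic by auto

lemma coefficient_limits:
  "(a \<longlongrightarrow> deriv f um) at_bot" "(a \<longlongrightarrow> deriv f up) at_top"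
  "(b \<longlongrightarrow> deriv M um) at_bot" "(b \<longlongrightarrow> deriv M up) at_top"
  unfolding a_def[abs_def] b_def[abs_def]
  by (intro isCont_tendsto_compose[OF _ U_at_bot] isCont_tendsto_compose[OF _ U_at_top]
        DERIV_isCont[OF f_derivs(2)] DERIV_isCont[OF M_derivs(2)] um_in up_in)+

end

section \<open>Independence of the three modes\<close>

lemma det_zero_imp_dependent:
  fixes x y z :: "complex^3"
  assumes "det (transpose (vector [x, y, z])) = 0"
  shows "\<exists>c1 c2 c3. (c1 \<noteq> 0 \<or> c2 \<noteq> 0 \<or> c3 \<noteq> 0) \<and> c1 *s x + c2 *s y + c3 *s z = 0"
proof -
  let ?A = "transpose (vector [x, y, z]) :: complex^3^3"
  have "\<not> invertible ?A" using assms invertible_det_nz by blast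
  then have "\<not> (\<forall>c. ?A *v c = 0 \<longrightarrow> c = 0)"
    unfolding invertible_left_inverse matrix_left_invertible_ker .
  then obtain c where c: "?A *v c = 0" "c \<noteq> 0" by blast
  have "?A *v c = c $ 1 *s x + c $ 2 *s y + c $ 3 *s z"
    by (simp add: vec_eq_iff matrix_vector_mult_def transpose_def sum_3 vector_3 mult.commute)
  moreover have "c $ 1 \<noteq> 0 \<or> c $ 2 \<noteq> 0 \<or> c $ 3 \<noteq> 0" using c(2) by (simp add: vec_eq_iff forall_3)
  ultimately show ?thesis using c(1) by metis
qed

lemma tendsto_smult_zero:
  fixes W :: "real \<Rightarrow> complex^'n"
  assumes "(W \<longlongrightarrow> 0) F"
  shows "((\<lambda>x. c *s W x) \<longlongrightarrow> 0) F"
proof (rule vec_tendstoI)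
  fix i
  have "((\<lambda>x. W x $ i) \<longlongrightarrow> 0) F" using tendsto_vec_nth[OF assms, of i] by simp
  then show "((\<lambda>x. (c *s W x) $ i) \<longlongrightarrow> 0 $ i) F" by (simp add: tendsto_mult_right_zero)
qed

lemma solves_eigen_system_cong:
  assumes sol: "solves_eigen_system L a b l W S" and S: "open S" and eq: "\<And>x. x \<in> S \<Longrightarrow> V x = W x"
  shows "solves_eigen_system L a b l V S"
  unfolding solves_eigen_system_def
proof (intro ballI)
  fix x assume x: "x \<in> S"
  have tr: "((\<lambda>s. V s $ i) has_vector_derivative d) (at x)"
    if "((\<lambda>s. W s $ i) has_vector_derivative d) (at x)" for i d
    by (rule has_vector_derivative_transform_within_open[OF that S x]) (simp add: eq)
  show "(\<exists>u'. ((\<lambda>s. V s $ 1) has_vector_derivative u') (at x) \<and>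
        of_real (a x) * u' =
          - (l + of_real (deriv a x) + of_real (L * b x)) * V x $ 1 + of_real L * V x $ 3) \<and>
     ((\<lambda>s. V s $ 2) has_vector_derivative (of_real (b x) * V x $ 1 - V x $ 3)) (at x) \<and>
     ((\<lambda>s. V s $ 3) has_vector_derivative (- V x $ 2)) (at x)"
    using sol x tr unfolding solves_eigen_system_def eq[OF x] by meson
qed

lemma solves_eigen_system_zero: "solves_eigen_system L a b l (\<lambda>_. 0) S"
  unfolding solves_eigen_system_def by (auto intro!: exI[of _ 0])

lemma bigo_decay:
  fixes W :: "real \<Rightarrow> complex^3"
  assumes "(\<lambda>x. norm (W x)) \<in> O[F](g)" and "(g \<longlongrightarrow> (0::real)) F"
  shows "(W \<longlongrightarrow> 0) F"
proof -
  obtain c where "eventually (\<lambda>x. norm (norm (W x)) \<le> c * norm (g x)) F"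
    using landau_o.bigE[OF assms(1)] by blast
  then have "eventually (\<lambda>x. norm (W x) \<le> norm (g x) * c) F" by (simp add: mult.commute)
  then show ?thesis by (rule tendsto_0_le[OF assms(2)])
qed

text \<open>\<open>A\<close> decays at the end \<open>FA\<close> outside \<open>S\<close>, \<open>B\<close> at the end \<open>FB\<close> of \<open>S\<close>, and \<open>C\<close> lives on \<open>S\<close>. A
  relation at one point of \<open>S\<close> holds on all of \<open>S\<close>, so \<open>c1 A + c2 C\<close>, with \<open>C\<close> extended by \<open>0\<close>, is a
  crossing solution that agrees with \<open>- c3 B\<close> on \<open>S\<close> and thus decays at both ends. It vanishes by
  \<open>no_localized_solution\<close>.\<close>

lemma (in damped_coefficients) modes_independent:
  assumes S: "S = {..<0} \<and> FA = at_top \<and> FB = at_bot \<or> S = {0<..} \<and> FA = at_bot \<and> FB = at_top"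
    and l: "l \<in> unstable_region"
    and a_nonzero: "\<And>x. x \<noteq> 0 \<Longrightarrow> a x \<noteq> 0" and deriv_a_cont: "continuous_on UNIV (deriv a)"
    and A: "crossing_solution L a b l A" "\<exists>x. x \<noteq> 0 \<and> x \<notin> S \<and> A x \<noteq> 0" "(A \<longlongrightarrow> 0) FA"
    and B: "crossing_solution L a b l B" "\<exists>x\<in>S. B x \<noteq> 0" "(B \<longlongrightarrow> 0) FB"
    and C: "solves_eigen_system L a b l C S" "\<exists>x\<in>S. C x \<noteq> 0" "(C \<longlongrightarrow> 0) (at 0 within S)"
    and y: "y \<in> S" and dep: "c1 *s A y + c2 *s C y + c3 *s B y = 0"
  shows "c1 = 0 \<and> c2 = 0 \<and> c3 = 0"
proof -
  define C' where "C' = (\<lambda>x. if x \<in> S then C x else 0)"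
  define V where "V = (\<lambda>x. c1 *s A x + c2 *s C' x)"
  have Sop: "open S" and Sint: "is_interval S" and S0: "0 \<notin> S" using S by (auto simp: is_interval_1)
  have half: "solves_eigen_system L a b l W S" if "crossing_solution L a b l W" for W
    using that S unfolding crossing_solution_def by auto
  have C'S: "solves_eigen_system L a b l C' S"
    by (rule solves_eigen_system_cong[OF C(1) Sop]) (simp add: C'_def)
  have C'sol: "solves_eigen_system L a b l C' {..<0}" "solves_eigen_system L a b l C' {0<..}"
    using S C'S solves_eigen_system_cong[OF solves_eigen_system_zero, of "{..<0}" C']
      solves_eigen_system_cong[OF solves_eigen_system_zero, of "{0<..}" C']
    by (auto simp: C'_def)
  have solV: "solves_eigen_system L a b l V {..<0}" "solves_eigen_system L a b l V {0<..}"
    using A(1) C'sol unfolding V_def crossing_solution_def by (auto intro: solves_eigen_system_lincomb)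
  have solVS: "solves_eigen_system L a b l V S" using solV S by auto
  have cont: "continuous_on S a" "continuous_on S (deriv a)" "continuous_on S b"
    using a_diff b_diff deriv_a_cont
    by (auto intro: continuous_on_subset continuous_at_imp_continuous_on differentiable_imp_continuous_within)
  have nz: "\<And>x. x \<in> S \<Longrightarrow> a x \<noteq> 0" using a_nonzero S0 by metis
  have VB: "V x = - (c3 *s B x)" if x: "x \<in> S" for x
  proof -
    have solZ: "solves_eigen_system L a b l (\<lambda>x. 1 *s V x + c3 *s B x) S"
      by (rule solves_eigen_system_lincomb[OF solVS half[OF B(1)]])
    have "1 *s V y + c3 *s B y = 0" using dep y by (simp add: V_def C'_def)
    from eigen_system_unique_zero[OF solZ Sint y x nz cont this]
    have "1 *s V x + c3 *s B x = 0" .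
    then show ?thesis by (simp add: eq_neg_iff_add_eq_0)
  qed
  have VA: "V x = c1 *s A x" if "x \<notin> S" for x using that by (simp add: V_def C'_def)
  have "eventually (\<lambda>x::real. x \<notin> {..<0}) at_top"
    by (rule eventually_mono[OF eventually_ge_at_top[of 0]]) auto
  moreover have "eventually (\<lambda>x::real. x \<notin> {0<..}) at_bot"
    by (rule eventually_mono[OF eventually_le_at_bot[of 0]]) auto
  moreover have "eventually (\<lambda>x::real. x \<in> {..<0}) at_bot"
    by (rule eventually_mono[OF eventually_gt_at_bot[of 0]]) auto
  moreover have "eventually (\<lambda>x::real. x \<in> {0<..}) at_top"
    by (rule eventually_mono[OF eventually_gt_at_top[of 0]]) auto
  ultimately have evB: "eventually (\<lambda>x. x \<in> S) FB" and evA: "eventually (\<lambda>x. x \<notin> S) FA"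
    using S by auto
  have limA: "(V \<longlongrightarrow> 0) FA"
    by (rule Lim_transform_eventually[OF tendsto_smult_zero[OF A(3), of c1]])
       (use evA VA in \<open>auto elim: eventually_mono\<close>)
  have limB: "(V \<longlongrightarrow> 0) FB"
    by (rule Lim_transform_eventually[OF tendsto_smult_zero[OF B(3), of "- c3"]])
       (use evB VB in \<open>auto elim!: eventually_mono\<close>)
  have ends: "(V \<longlongrightarrow> 0) at_bot" "(V \<longlongrightarrow> 0) at_top" using S limA limB by auto
  have in_S: "eventually (\<lambda>x. C x = C' x) (at 0 within S)"
    unfolding eventually_at_filter by (rule always_eventually) (simp add: C'_def)
  have off_S: "eventually (\<lambda>x. 0 = C' x) (at 0 within T)" if "T \<inter> S = {}" for T
    unfolding eventually_at_filter by (rule always_eventually) (use that in \<open>auto simp: C'_def\<close>)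
  have disj: "{..<0::real} \<inter> {0<..} = {}" "{0<..} \<inter> {..<0::real} = {}" by auto
  have C'0: "(C' \<longlongrightarrow> 0) (at 0)"
  proof (rule filterlim_split_at)
    have 1: "(C' \<longlongrightarrow> 0) (at 0 within S)" by (rule Lim_transform_eventually[OF C(3) in_S])
    show "(C' \<longlongrightarrow> 0) (at_left 0)"
      using S 1 Lim_transform_eventually[OF tendsto_const off_S[of "{..<0}"]] disj by auto
    show "(C' \<longlongrightarrow> 0) (at_right 0)"
      using S 1 Lim_transform_eventually[OF tendsto_const off_S[of "{0<..}"]] disj by auto
  qed
  have C'i: "((\<lambda>x. C' x $ i) \<longlongrightarrow> 0) (at 0)" for i using tendsto_vec_nth[OF C'0, of i] by simp
  have lim: "((\<lambda>x. V x $ i) \<longlongrightarrow> c1 * A 0 $ i + c2 * 0) (at 0)" if "isCont (\<lambda>x. A x $ i) 0" for i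
  proof -
    have "((\<lambda>x. c1 * A x $ i + c2 * C' x $ i) \<longlongrightarrow> c1 * A 0 $ i + c2 * 0) (at 0)"
      using that unfolding isCont_def by (intro tendsto_add tendsto_mult tendsto_const C'i)
    then show ?thesis by (simp add: V_def)
  qed
  have "isCont a 0" using a_diff by (auto intro: differentiable_imp_continuous_within)
  then have a0: "(a \<longlongrightarrow> a 0) (at 0)" by (simp add: isCont_def)
  have "((\<lambda>x. c1 * (of_real (a x) * A x $ 1) + c2 * (of_real (a x) * C' x $ 1))
     \<longlongrightarrow> c1 * 0 + c2 * (of_real (a 0) * 0)) (at 0)"
    using A(1) unfolding crossing_solution_def
    by (intro tendsto_add tendsto_mult tendsto_const tendsto_of_real a0 C'i) auto
  then have u: "((\<lambda>x. of_real (a x) * V x $ 1) \<longlongrightarrow> 0) (at 0)"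
    unfolding V_def by (simp add: algebra_simps)
  have V0: "V x = 0" if "x \<noteq> 0" for x
    using A(1) unfolding crossing_solution_def
    by (intro no_localized_solution[OF solV l u lim lim ends that]) auto
  have c1: "c1 = 0"
  proof -
    obtain x where x: "x \<noteq> 0" "x \<notin> S" "A x \<noteq> 0" using A(2) by blast
    then show ?thesis using V0[OF x(1)] VA[OF x(2)] by simp
  qed
  have c3: "c3 = 0"
  proof -
    obtain x where x: "x \<in> S" "B x \<noteq> 0" using B(2) by blast
    then have "x \<noteq> 0" using S0 by auto
    then show ?thesis using V0[of x] VB[OF x(1)] x by simp
  qed
  have c2: "c2 = 0"
  proof -
    obtain x where x: "x \<in> S" "C x \<noteq> 0" using C(2) by blast
    then have "x \<noteq> 0" using S0 by auto
    then show ?thesis using V0[of x] x c1 by (simp add: V_def C'_def)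
  qed
  show ?thesis using c1 c2 c3 by simp
qed

text \<open>The signs of the eigenvalues \<open>mu3_plus\<close> and \<open>mu3_minus\<close> turn the exponential bounds on the modes into
  decay, and a vanishing determinant is a linear relation that \<open>modes_independent\<close> excludes.\<close>

lemma (in shock_profile) condition_D_if_b_slow:
  assumes slow: "\<And>x. \<bar>deriv b x\<bar> < 2 * \<bar>b x\<bar>"
  shows "condition_D f M L um up U"
proof -
  have M_ends: "L * deriv M um > 0" "L * deriv M up > 0" using LM_pos um_in up_in by blast+
  interpret damped_coefficients L a b "deriv f um" "deriv M um" "deriv f up" "deriv M up"
  proof
    show "a differentiable at x" "b differentiable at x" for x
      using a_deriv b_deriv real_differentiable_def by blast+
  qed (use a_deriv_nonpos Lb_pos slow coefficient_limits M_ends in auto)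
  show ?thesis
    unfolding condition_D_def a_def[abs_def, symmetric] b_def[abs_def, symmetric]
  proof (intro allI impI ballI)
    fix W1p W2p W2m W3m :: "complex \<Rightarrow> real \<Rightarrow> complex^3" and l
    assume modes: "evans_modes L a b (deriv f um) (deriv M um) (deriv f up) (deriv M up) W1p W2p W2m W3m"
      and l: "l \<in> unstable_region"
    have W1: "is_W1_plus L a b (deriv f up) (deriv M up) l (W1p l)"
      and W2p: "is_W2 L a b {..<0} l (W2p l)" and W2m: "is_W2 L a b {0<..} l (W2m l)"
      and W3: "is_W3_minus L a b (deriv f um) (deriv M um) l (W3m l)"
      using modes l unfolding evans_modes_def by auto
    have "Re (mu3_plus L (deriv f up) (deriv M up) l) < 0"
      by (rule mu3_plus_neg[OF a_ends(2) M_ends(2) l])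
    then have "((\<lambda>x. exp (Re (mu3_plus L (deriv f up) (deriv M up) l) * x)) \<longlongrightarrow> 0) at_top"
      by (intro filterlim_compose[OF exp_at_bot] filterlim_tendsto_neg_mult_at_bot[OF tendsto_const])
         (auto simp: filterlim_ident)
    then have d1: "(W1p l \<longlongrightarrow> 0) at_top"
      using W1 bigo_decay unfolding is_W1_plus_def by blast
    have "Re (mu3_minus L (deriv f um) (deriv M um) l) > 0"
      by (rule mu3_minus_pos[OF a_ends(1) M_ends(1) l])
    then have "((\<lambda>x. exp (Re (mu3_minus L (deriv f um) (deriv M um) l) * x)) \<longlongrightarrow> 0) at_bot"
      by (intro filterlim_compose[OF exp_at_bot] filterlim_tendsto_pos_mult_at_bot[OF tendsto_const])
         (auto simp: filterlim_ident)
    then have d3: "(W3m l \<longlongrightarrow> 0) at_bot"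
      using W3 bigo_decay unfolding is_W3_minus_def by blast
    have c1: "crossing_solution L a b l (W1p l)" and n1: "\<exists>x>0. W1p l x \<noteq> 0"
      and c3: "crossing_solution L a b l (W3m l)" and n3: "\<exists>x<0. W3m l x \<noteq> 0"
      using W1 W3 unfolding is_W1_plus_def is_W3_minus_def by blast+
    have n1': "\<exists>x. x \<noteq> 0 \<and> x \<notin> {..<0} \<and> W1p l x \<noteq> 0" "\<exists>x\<in>{0<..}. W1p l x \<noteq> 0"
      using n1 by (metis lessThan_iff less_asym less_irrefl, metis greaterThan_iff)
    have n3': "\<exists>x. x \<noteq> 0 \<and> x \<notin> {0<..} \<and> W3m l x \<noteq> 0" "\<exists>x\<in>{..<0}. W3m l x \<noteq> 0"
      using n3 by (metis greaterThan_iff less_asym less_irrefl, metis lessThan_iff)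
    have W2p': "solves_eigen_system L a b l (W2p l) {..<0}" "\<exists>x\<in>{..<0}. W2p l x \<noteq> 0"
      "(W2p l \<longlongrightarrow> 0) (at 0 within {..<0})" using W2p unfolding is_W2_def by blast+
    have W2m': "solves_eigen_system L a b l (W2m l) {0<..}" "\<exists>x\<in>{0<..}. W2m l x \<noteq> 0"
      "(W2m l \<longlongrightarrow> 0) (at 0 within {0<..})" using W2m unfolding is_W2_def by blast+
    show "D_plus W1p W2m W3m l \<noteq> 0 \<and> D_minus W1p W2p W3m l \<noteq> 0"
    proof (intro conjI notI)
      assume "D_plus W1p W2m W3m l = 0"
      then obtain k1 k2 k3 where k: "k1 \<noteq> 0 \<or> k2 \<noteq> 0 \<or> k3 \<noteq> 0"
        and "k1 *s W1p l 1 + k2 *s W2m l 1 + k3 *s W3m l 1 = 0"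
        unfolding D_plus_def evans_det_def using det_zero_imp_dependent by blast
      then have dep: "k3 *s W3m l 1 + k2 *s W2m l 1 + k1 *s W1p l 1 = 0" by (simp add: ac_simps)
      have "k3 = 0 \<and> k2 = 0 \<and> k1 = 0"
        by (rule modes_independent[OF _ l a_nonzero deriv_a_cont c3 n3'(1) d3 c1 n1'(2) d1 W2m' _ dep]) auto
      then show False using k by simp
    next
      assume "D_minus W1p W2p W3m l = 0"
      then obtain k1 k2 k3 where k: "k1 \<noteq> 0 \<or> k2 \<noteq> 0 \<or> k3 \<noteq> 0"
        and dep: "k1 *s W1p l (- 1) + k2 *s W2p l (- 1) + k3 *s W3m l (- 1) = 0"
        unfolding D_minus_def evans_det_def using det_zero_imp_dependent by blast
      have "k1 = 0 \<and> k2 = 0 \<and> k3 = 0"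
        by (rule modes_independent[OF _ l a_nonzero deriv_a_cont c1 n1'(1) d1 c3 n3'(2) d3 W2p' _ dep]) auto
      then show False using k by simp
    qed
  qed
qed

text \<open>Here \<open>m\<close> bounds \<open>L b\<close> from below along the profile, \<open>k\<close> is the slope to be excluded, and the last
  assumption measures the amplitude. The quadratic of \<open>slope_bound\<close> is then at most
  \<open>- k m / 2 + R < 0\<close> at \<open>k\<close>, and \<open>|L b'| \<le> |L M''(U)| k < m\<close>.\<close>

lemma (in shock_profile) b_slow_if_weak:
  assumes k: "k > 0" and A5: "A5 2 L a b"
    and m: "\<And>x. L * b x \<ge> m" and A: "\<And>x. deriv (deriv f) (U x) * k \<le> m / 2"
    and B: "\<And>x. \<bar>L * deriv (deriv M) (U x)\<bar> * k < m"
    and R: "f um - f (U 0) < k * m / 2"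
  shows "\<bar>deriv b x\<bar> < 2 * \<bar>b x\<bar>"
proof -
  have "- deriv U x < k"
  proof (rule slope_bound[OF k])
    fix y
    have "deriv (deriv f) (U y) * k\<^sup>2 \<le> m / 2 * k"
      using mult_right_mono[OF A[of y] less_imp_le[OF k]] by (simp add: power2_eq_square)
    moreover have "m * k \<le> L * b y * k" using mult_right_mono[OF m[of y] less_imp_le[OF k]] .
    ultimately show "deriv (deriv f) (U y) * k\<^sup>2 - L * b y * k + R y < 0"
      using R_le[of y] R by (simp add: mult.commute[of k])
  next
    have "deriv a 0 \<le> 0" by (rule a_deriv_nonpos)
    then show "L * b 0 + 2 * deriv a 0 > 0" using A5 by (simp add: A5_def algebra_simps)
  qed
  then have U: "\<bar>deriv U x\<bar> \<le> k" using deriv_U_nonpos[of x] by simp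
  have L0: "\<bar>L\<bar> > 0" using Lb_pos[of x] by auto
  have m0: "m > 0" using order.strict_trans1[OF _ B[of x], of 0] k by simp
  have "\<bar>L\<bar> * \<bar>deriv b x\<bar> = \<bar>L * deriv (deriv M) (U x)\<bar> * \<bar>deriv U x\<bar>"
    using DERIV_imp_deriv[OF b_deriv[of x]] by (simp add: abs_mult)
  also have "\<dots> \<le> \<bar>L * deriv (deriv M) (U x)\<bar> * k" using U by (intro mult_left_mono) auto
  also have "\<dots> < m" by (rule B)
  also have "\<dots> \<le> \<bar>L\<bar> * \<bar>b x\<bar>" using m[of x] Lb_pos[of x] by (simp add: abs_mult[symmetric])
  finally have "\<bar>deriv b x\<bar> < \<bar>b x\<bar>" using L0 by simp
  then show ?thesis by simp
qed

theorem proposition1p5: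
  fixes f M :: "real \<Rightarrow> real" and L :: real and I :: "real set"
  assumes I: "open I" "is_interval I"
    and A0: "Ck_on 5 f I" "Ck_on 5 M I"
    and A1: "\<And>u. u \<in> I \<Longrightarrow> deriv (deriv f) u > 0"
    and A4: "\<And>u. u \<in> I \<Longrightarrow> L * deriv M u > 0"
  shows "\<exists>\<epsilon>>0. \<forall>u_minus u_plus U Q.
    u_minus \<in> I \<and> u_plus \<in> I \<and> f u_minus = f u_plus \<and> u_plus < u_minus \<and>
    radiative_profile I f M L u_minus u_plus U Q \<and>
    (\<forall>k\<in>{1..4}. A5 k L (\<lambda>x. deriv f (U x)) (\<lambda>x. deriv M (U x))) \<and>
    ((\<exists>c. \<forall>x. deriv M (U x) = c) \<or> \<bar>u_plus - u_minus\<bar> < \<epsilon>)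
    \<longrightarrow> condition_D f M L u_minus u_plus U"
proof (cases "\<exists>s\<in>I. deriv f s = 0")
  case False
  have "\<not> radiative_profile I f M L u_minus u_plus U Q" for u_minus u_plus U Q
  proof
    assume "radiative_profile I f M L u_minus u_plus U Q"
    then have "deriv f (U 0) = 0" "U 0 \<in> I" unfolding radiative_profile_def by auto
    then show False using False by blast
  qed
  then show ?thesis by (intro exI[of _ 1]) auto
next
  case True
  then obtain s where s: "s \<in> I" "deriv f s = 0" by blast
  obtain r where r: "r > 0" "cball s r \<subseteq> I" using I(1) s(1) open_contains_cball by blast
  let ?K = "cball s r"
  have sK: "s \<in> ?K" using r by simp
  have cont: "continuous_on ?K (deriv g)" "continuous_on ?K (deriv (deriv g))" if "Ck_on 5 g I" for g
  proof -
    have "isCont (deriv g) u" "isCont (deriv (deriv g)) u" if u: "u \<in> ?K" for u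
      using u r(2) Ck_on_5_derivs(3)[OF \<open>Ck_on 5 g I\<close>, of u]
        DERIV_isCont[OF Ck_on_5_derivs(2)[OF \<open>Ck_on 5 g I\<close>, of u]] by blast+
    then show "continuous_on ?K (deriv g)" "continuous_on ?K (deriv (deriv g))"
      by (simp_all add: continuous_at_imp_continuous_on)
  qed
  note cf = cont[OF A0(1)] and cM = cont[OF A0(2)]
  \<comment> \<open>Small profiles take their values in the compact neighbourhood \<open>?K\<close> of the sonic state \<open>s\<close>,
    which does not depend on the end states; all constants come from extreme values on \<open>?K\<close>.\<close>
    obtain um where um: "um \<in> ?K" "\<And>u. u \<in> ?K \<Longrightarrow> L * deriv M um \<le> L * deriv M u"
    using continuous_attains_inf[OF compact_cball, of s r "\<lambda>u. L * deriv M u"] sK cM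
    by (fastforce intro: continuous_intros)
  define m where "m = L * deriv M um"
  have m0: "m > 0" using A4 um(1) r(2) by (auto simp: m_def)
  obtain ua where ua: "ua \<in> ?K" "\<And>u. u \<in> ?K \<Longrightarrow> deriv (deriv f) u \<le> deriv (deriv f) ua"
    using continuous_attains_sup[OF compact_cball _ cf(2)] sK by blast
  define A where "A = deriv (deriv f) ua"
  have A0': "A > 0" using A1 ua(1) r(2) by (auto simp: A_def)
  obtain ub where ub: "ub \<in> ?K" "\<And>u. u \<in> ?K \<Longrightarrow> \<bar>L * deriv (deriv M) u\<bar> \<le> \<bar>L * deriv (deriv M) ub\<bar>"
    using continuous_attains_sup[OF compact_cball, of s r "\<lambda>u. \<bar>L * deriv (deriv M) u\<bar>"] sK cM
    by (fastforce intro: continuous_intros)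
  define B where "B = \<bar>L * deriv (deriv M) ub\<bar>"
  have B0: "B \<ge> 0" by (simp add: B_def)
  \<comment> \<open>The first entry makes \<open>k\<close> admissible for \<open>slope_bound\<close>, the second one makes \<open>b'\<close> small.\<close>
    define k where "k = min (m / (2 * A)) (m / (B + 1))"
  have k0: "k > 0" using m0 A0' B0 by (auto simp: k_def intro!: divide_pos_pos)
  have kA: "A * k \<le> m / 2"
    using mult_left_mono[of k "m / (2 * A)" A] A0' by (auto simp: k_def)
  have "(B + 1) * k \<le> m"
    using mult_left_mono[of k "m / (B + 1)" "B + 1"] B0 by (auto simp: k_def)
  then have kB: "B * k < m" using k0 by (simp add: algebra_simps)
  have "f field_differentiable at s"
    using A0(1) s(1) unfolding Ck_on_def by (metis funpow_0 zero_less_numeral)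
  then have "isCont f s" by (rule field_differentiable_imp_continuous_at)
  moreover have "k * m / 2 > 0" using k0 m0 by simp
  ultimately obtain d where d: "d > 0" "\<And>u. \<bar>u - s\<bar> < d \<Longrightarrow> \<bar>f u - f s\<bar> < k * m / 2"
    unfolding continuous_at_eps_delta dist_real_def by meson
  show ?thesis
  proof (intro exI[of _ "min r d"] conjI allI impI)
    show "min r d > 0" using r d by simp
    fix u_minus u_plus U Q
    assume H: "u_minus \<in> I \<and> u_plus \<in> I \<and> f u_minus = f u_plus \<and> u_plus < u_minus \<and>
      radiative_profile I f M L u_minus u_plus U Q \<and>
      (\<forall>k\<in>{1..4}. A5 k L (\<lambda>x. deriv f (U x)) (\<lambda>x. deriv M (U x))) \<and>
      ((\<exists>c. \<forall>x. deriv M (U x) = c) \<or> \<bar>u_plus - u_minus\<bar> < min r d)"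
    interpret P: shock_profile I f M L u_minus u_plus U Q
      using H I A0 A1 A4 by unfold_locales auto
    show "condition_D f M L u_minus u_plus U"
    proof (rule P.condition_D_if_b_slow)
      fix x
      have b0: "\<bar>P.b x\<bar> > 0" using P.Lb_pos[of x] by auto
      from H consider c where "\<forall>x. deriv M (U x) = c" | "\<bar>u_plus - u_minus\<bar> < min r d" by blast
      then show "\<bar>deriv P.b x\<bar> < 2 * \<bar>P.b x\<bar>"
      proof cases
        case 1
        then have "P.b = (\<lambda>_. c)" by (auto simp: P.b_def)
        then show ?thesis using b0 by simp
      next
        case 2
        have "U 0 = s"
          using P.deriv_f_less[of "U 0" s] P.deriv_f_less[of s "U 0"] P.sonic P.U_in[of 0] s
          by (cases "U 0" s rule: linorder_cases) auto
        then have between: "u_plus < s" "s < u_minus" using P.sonic_between by auto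
        have UK: "U y \<in> ?K" for y
          using between 2 P.U_le[of y] P.U_ge[of y] by (auto simp: dist_real_def)
        show ?thesis
        proof (rule P.b_slow_if_weak[OF k0, of m])
          show "A5 2 L P.a P.b" using H by (simp add: P.a_def[abs_def] P.b_def[abs_def])
          show "m \<le> L * P.b y" for y using um(2)[OF UK] by (simp add: m_def P.b_def)
          show "deriv (deriv f) (U y) * k \<le> m / 2" for y
            using mult_right_mono[OF ua(2)[OF UK[of y]] less_imp_le[OF k0]] kA by (simp add: A_def)
          show "\<bar>L * deriv (deriv M) (U y)\<bar> * k < m" for y
            using mult_right_mono[OF ub(2)[OF UK[of y]] less_imp_le[OF k0]] kB by (simp add: B_def)
          show "f u_minus - f (U 0) < k * m / 2"
            using abs_ge_self[of "f u_minus - f s"] d(2)[of u_minus] between 2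
            unfolding \<open>U 0 = s\<close> by linarith
        qed
      qed
    qed
  qed
qed

end
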